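(* Let $G_H = (V_H, E_H)$ be the hexagonal grid, with $V_H = \mathbb{Z}^2$ and \[ E_H = \{ \{ u=(i,j), v \} : u, v \in \mathbb{Z}^2,\ u - v \in \{(0,(-1)^{i+j+1}), (1,0), (-1,0)\} \}. \] If $C \subseteq V_H$ is a $2$-identifying code in $G_H$, then its density satisfies $D(C) \geq \frac{4}{19}$.
   Context: For vertices $u,v$ of $G_H$, $d(u,v)$ is the graph distance, and $B_2(u) = \{x \in V_H : d(u,x) \le 2\}$. A code $C \subseteq V_H$ (non-empty) is $2$-identifying if for every $u \in V_H$ the set $I_2(C;u) = B_2(u) \cap C$ is non-empty and for all distinct $u,v \in V_H$, $I_2(C;u) \neq I_2(C;v)$. With $Q_n = \{(x,y) \in \mathbb{Z}^2 : |x| \le n, |y| \le n\}$, the density of $C$ is $D(C) = \limsup_{n \to \infty} \frac{|C \cap Q_n|}{|Q_n|}$. *)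

theory Defs
  imports Complex_Main "HOL-Library.Extended_Nat" "HOL-Library.Extended_Real"
    "HOL-Library.Liminf_Limsup" "HOL-Library.Product_Plus"
begin

definition graph_dist :: "'a set set \<Rightarrow> 'a \<Rightarrow> 'a \<Rightarrow> enat" where
  "graph_dist E u v = Inf {enat n | n. (u, v) \<in> {(x, y). {x, y} \<in> E} ^^ n}"

definition graph_ball :: "'a set \<Rightarrow> 'a set set \<Rightarrow> nat \<Rightarrow> 'a \<Rightarrow> 'a set" where
  "graph_ball V E r u = {x \<in> V. graph_dist E u x \<le> enat r}"

definition I_set :: "'a set \<Rightarrow> 'a set set \<Rightarrow> nat \<Rightarrow> 'a set \<Rightarrow> 'a \<Rightarrow> 'a set" where
  "I_set V E r C u = graph_ball V E r u \<inter> C"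

definition identifying_code :: "'a set \<Rightarrow> 'a set set \<Rightarrow> nat \<Rightarrow> 'a set \<Rightarrow> bool" where
  "identifying_code V E r C \<longleftrightarrow>
     C \<subseteq> V \<and> C \<noteq> {} \<and>
     (\<forall>u\<in>V. I_set V E r C u \<noteq> {}) \<and>
     (\<forall>u\<in>V. \<forall>v\<in>V. u \<noteq> v \<longrightarrow> I_set V E r C u \<noteq> I_set V E r C v)"

definition hex_V :: "(int \<times> int) set" where
  "hex_V = UNIV"

text \<open>The conditional is $(-1)^{i+j+1}$, written without an integer exponent.\<close>

definition hex_E :: "(int \<times> int) set set" where
  "hex_E = {{u, v} | u v i j. u = (i, j) \<and>
     u - v \<in> {(0, if even (i + j + 1) then 1 else -1), (1, 0), (-1, 0)}}"

definition Q_box :: "nat \<Rightarrow> (int \<times> int) set" where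
  "Q_box n = {(x, y). \<bar>x\<bar> \<le> int n \<and> \<bar>y\<bar> \<le> int n}"

definition code_density :: "(int \<times> int) set \<Rightarrow> ereal" where
  "code_density C = limsup (\<lambda>n. ereal (real (card (C \<inter> Q_box n)) / real (card (Q_box n))))"

end

theory Submission imports Defs begin

text \<open>
  Every vertex \<open>w\<close> hands at least one unit of weight to the codewords of \<open>I w = B w \<inter> C\<close>: each of the \<open>k\<close>
  codewords gets \<open>1/k\<close>, or \<open>1/4\<close> if \<open>k > 4\<close>. It suffices that codewords get at most \<open>19/4\<close> on average.
  Some get up to \<open>5\<close>, so weight is moved between codewords by ten local rules, chosen such that
  afterwards nobody holds more than \<open>19/4\<close>. Whether a rule moves weight from \<open>c\<close> to \<open>d\<close> depends only on
  the code within distance 4 of both \<open>c\<close> and \<open>d\<close>. Hence the final weight of \<open>c\<close> is a function of the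
  code in the 30 vertices around \<open>c\<close> up to distance 4, and the bound for it is a finite problem:
  the only hypothesis needed is that the ten vertices of \<open>B c\<close> have pairwise different sets \<open>I\<close>.
  Over a large box the movements cancel up to a boundary term. The rules come from a linear
  program, whose variables are the amounts moved for each possible pattern.
\<close>

subsection \<open>The hexagonal grid\<close>


definition parity_sign :: "int \<times> int \<Rightarrow> int" where
  "parity_sign c = (if even (fst c + snd c) then 1 else -1)"

text \<open>
  The coordinates of the grid as seen from \<open>c\<close>. At odd vertices the grid is rotated by a half-turn,
  so that \<open>frame c\<close> is always a graph automorphism.
\<close>

definition frame :: "int \<times> int \<Rightarrow> int \<times> int \<Rightarrow> int \<times> int" where
  "frame c x = (fst c + parity_sign c * fst x, snd c + parity_sign c * snd x)"

text \<open>Changing the sign of a coordinate keeps its parity, so the parity of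
  \<open>frame c p\<close> is that of \<open>c\<close> plus that of \<open>p\<close>.\<close>

lemma parity_sign_frame: "parity_sign (frame c p) = parity_sign c * parity_sign p"
  unfolding parity_sign_def frame_def by (simp; presburger)

text \<open>As the signs multiply, \<open>frame\<close> is an associative operation with unit
  \<open>(0, 0)\<close>. This law re-expresses positions relative to one vertex as positions
  relative to another, for instance from sender to receiver.\<close>

lemma frame_frame: "frame (frame c p) x = frame c (frame p x)"
  unfolding frame_def[of "frame c p"] parity_sign_frame by (simp add: frame_def algebra_simps)

lemma frame_zero [simp]: "frame c (0, 0) = c"
  by (simp add: frame_def)

lemma frame_inj_iff: "frame c x = frame c y \<longleftrightarrow> x = y"
  by (auto simp: frame_def parity_sign_def prod_eq_iff)

section \<open>Neighbours and balls of radius two\<close>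

definition nbr_offsets :: "(int \<times> int) set" where
  "nbr_offsets = {(1, 0), (-1, 0), (0, 1)}"

text \<open>The order is that of the centers \<open>U0\<close> to \<open>U9\<close>, on which
  \<open>centers_eq\<close> relies.\<close>

definition ball_offsets :: "(int \<times> int) list" where
  "ball_offsets = [(0,0), (-1,0), (1,0), (0,1), (-2,0), (-1,-1), (2,0), (1,-1), (-1,1), (1,1)]"

lemma hex_edge_iff: "{x, y} \<in> hex_E \<longleftrightarrow> y \<in> frame x ` nbr_offsets"
proof -
  have dir: "u - v \<in> {(0, if even (fst u + snd u + 1) then 1 else -1), (1, 0), (-1, 0)}
      \<longleftrightarrow> v \<in> frame u ` nbr_offsets" for u v :: "int \<times> int"
    by (auto simp: nbr_offsets_def frame_def parity_sign_def minus_prod_def prod_eq_iff)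
  \<comment> \<open>\<open>hex_E\<close> describes an edge from one chosen end; this symmetry makes
    the choice irrelevant.\<close>
  have sym: "v \<in> frame u ` nbr_offsets \<Longrightarrow> u \<in> frame v ` nbr_offsets" for u v
    by (auto simp: nbr_offsets_def frame_def parity_sign_def prod_eq_iff)
  have "{x, y} \<in> hex_E \<longleftrightarrow> (\<exists>u v. {x, y} = {u, v} \<and> v \<in> frame u ` nbr_offsets)"
    unfolding hex_E_def dir[symmetric] by auto
  also have "\<dots> \<longleftrightarrow> y \<in> frame x ` nbr_offsets"
    unfolding doubleton_eq_iff using sym by blast
  finally show ?thesis .
qed

text \<open>The infimum of the empty set in \<open>enat\<close> is infinite, so a finite distance
  comes from a nonempty set and is attained by a walk.\<close>

lemma graph_dist_le_iff:
  "graph_dist E u v \<le> enat r \<longleftrightarrow> (\<exists>n\<le>r. (u, v) \<in> {(x, y). {x, y} \<in> E} ^^ n)"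
proof
  let ?D = "{enat n | n. (u, v) \<in> {(x, y). {x, y} \<in> E} ^^ n}"
  assume le: "graph_dist E u v \<le> enat r"
  then have "?D \<noteq> {}"
    by (auto simp: graph_dist_def Inf_enat_def split: if_splits)
  then have "Inf ?D \<in> ?D"
    unfolding Inf_enat_def by (auto intro: LeastI)
  with le show "\<exists>n\<le>r. (u, v) \<in> {(x, y). {x, y} \<in> E} ^^ n"
    unfolding graph_dist_def by auto
next
  assume "\<exists>n\<le>r. (u, v) \<in> {(x, y). {x, y} \<in> E} ^^ n"
  then obtain n where "n \<le> r" "(u, v) \<in> {(x, y). {x, y} \<in> E} ^^ n"
    by blast
  then show "graph_dist E u v \<le> enat r"
    unfolding graph_dist_def by (intro Inf_lower2[of "enat n"]) auto
qed

lemma hex_ball: "graph_ball hex_V hex_E 2 u = frame u ` set ball_offsets"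
proof -
  let ?R = "{(x, y). {x, y} \<in> hex_E}"
  have R: "?R = {(x, y). y \<in> frame x ` nbr_offsets}"
    by (simp add: hex_edge_iff)
  have two: "(u, x) \<in> ?R ^^ 2 \<longleftrightarrow> (\<exists>a\<in>nbr_offsets. \<exists>b\<in>nbr_offsets. x = frame u (frame a b))" for x
  proof -
    have "(u, x) \<in> ?R ^^ 2 \<longleftrightarrow> (\<exists>y. (u, y) \<in> ?R \<and> (y, x) \<in> ?R)"
      by (auto simp: numeral_2_eq_2)
    also have "\<dots> \<longleftrightarrow> (\<exists>a\<in>nbr_offsets. \<exists>b\<in>nbr_offsets. x = frame (frame u a) b)"
      unfolding R by blast
    finally show ?thesis
      by (simp add: frame_frame)
  qed
  \<comment> \<open>Two steps lead either back to the start or to one of the six vertices at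
    distance two.\<close>
  have set: "set ball_offsets = {(0, 0)} \<union> nbr_offsets \<union> (\<Union>a\<in>nbr_offsets. frame a ` nbr_offsets)"
    by (auto simp: ball_offsets_def nbr_offsets_def frame_def parity_sign_def)
  have "x \<in> graph_ball hex_V hex_E 2 u \<longleftrightarrow> x = u \<or> x \<in> frame u ` nbr_offsets \<or>
      (\<exists>a\<in>nbr_offsets. \<exists>b\<in>nbr_offsets. x = frame u (frame a b))" for x
  proof -
    have "x \<in> graph_ball hex_V hex_E 2 u \<longleftrightarrow> (\<exists>n\<le>2. (u, x) \<in> ?R ^^ n)"
      by (simp add: graph_ball_def hex_V_def graph_dist_le_iff)
    also have "\<dots> \<longleftrightarrow> (u, x) \<in> ?R ^^ 0 \<or> (u, x) \<in> ?R ^^ 1 \<or> (u, x) \<in> ?R ^^ 2"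
      by (auto simp: le_Suc_eq numeral_2_eq_2 simp del: relpow.simps)
    finally show ?thesis
      unfolding two by (auto simp: hex_edge_iff)
  qed
  then show ?thesis
    unfolding set by (simp only: set_eq_iff image_Un image_UN Un_iff UN_iff image_insert image_empty
        frame_zero singleton_iff) blast
qed

subsection \<open>Density\<close>

lemma Q_box_eq: "Q_box n = {- int n..int n} \<times> {- int n..int n}"
  by (auto simp: Q_box_def)

lemma finite_Q_box [simp]: "finite (Q_box n)"
  by (simp add: Q_box_eq)

lemma card_Q_box: "card (Q_box n) = (2 * n + 1)\<^sup>2"
  by (simp add: Q_box_eq card_cartesian_product power2_eq_square nat_add_distrib nat_mult_distrib)

lemma Q_box_mono: "m \<le> n \<Longrightarrow> Q_box m \<subseteq> Q_box n"
  by (auto simp: Q_box_def)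

text \<open>The ring has linear size and the box quadratic size. Hence the ring vanishes in the
  limit, which leaves \<open>48 / 228 = 4 / 19\<close>.\<close>

lemma code_density_ge:
  assumes count: "\<And>n. 48 * card (Q_box n)
      \<le> 228 * card (C \<inter> Q_box (n + 2)) + K * card (Q_box (n + 6) - Q_box (n + 2))"
  shows "code_density C \<ge> ereal (4 / 19)"
proof -
  let ?f = "\<lambda>n. real (card (C \<inter> Q_box n)) / real (card (Q_box n))"
  \<comment> \<open>The hypothesis is used with \<open>n - 2\<close> for \<open>n\<close>: the boxes
    of radius \<open>n - 2\<close>, \<open>n\<close> and \<open>n + 4\<close> have side lengths
    \<open>2 n - 3\<close>, \<open>2 n + 1\<close> and \<open>2 n + 9\<close>.\<close>
  let ?g = "\<lambda>n. (48 * (2 * real n - 3)\<^sup>2 - real K * ((2 * real n + 9)\<^sup>2 - (2 * real n + 1)\<^sup>2))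
      / (228 * (2 * real n + 1)\<^sup>2)"
  have "?g n \<le> ?f n" if ge: "n \<ge> 2" for n
  proof -
    obtain m where n: "n = m + 2"
      using le_Suc_ex[OF ge] by (auto simp: add.commute)
    have "card (Q_box (m + 6)) = card (Q_box (m + 6) - Q_box (m + 2)) + card (Q_box (m + 2))"
      using card_Diff_subset[OF _ Q_box_mono[of "m + 2" "m + 6"]] card_mono[OF _ Q_box_mono[of "m + 2" "m + 6"]]
      by simp
    then have "real (card (Q_box (m + 6))) = real (card (Q_box (m + 6) - Q_box (m + 2))) + real (card (Q_box (m + 2)))"
      by simp
    then have diff: "real (card (Q_box (m + 6) - Q_box (m + 2))) = (2 * real n + 9)\<^sup>2 - (2 * real n + 1)\<^sup>2"
      by (simp add: card_Q_box n)
    have "real (48 * card (Q_box m))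
        \<le> real (228 * card (C \<inter> Q_box n) + K * card (Q_box (m + 6) - Q_box (m + 2)))"
      using count[of m] n by (intro of_nat_mono) simp
    moreover have "real (card (Q_box m)) = (2 * real n - 3)\<^sup>2"
      by (simp add: card_Q_box n)
    ultimately have "48 * (2 * real n - 3)\<^sup>2 - real K * ((2 * real n + 9)\<^sup>2 - (2 * real n + 1)\<^sup>2)
        \<le> 228 * real (card (C \<inter> Q_box n))"
      using diff by simp
    then have "?g n \<le> 228 * real (card (C \<inter> Q_box n)) / (228 * (2 * real n + 1)\<^sup>2)"
      by (intro divide_right_mono) auto
    also have "\<dots> = ?f n"
      by (simp add: card_Q_box)
    finally show ?thesis .
  qed
  then have le: "eventually (\<lambda>n. ereal (?g n) \<le> ereal (?f n)) sequentially"
    by (auto intro: eventually_sequentiallyI)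
  \<comment> \<open>This is \<open>?g\<close> with numerator and denominator divided by the square
    of \<open>n\<close>; the difference of the two squares is \<open>32 n + 80\<close>.\<close>
  have "(\<lambda>n. (48 * (2 - 3 * inverse (real n))\<^sup>2 - real K * (32 * inverse (real n) + 80 * (inverse (real n))\<^sup>2))
      / (228 * (2 + inverse (real n))\<^sup>2))
    \<longlonglongrightarrow> (48 * (2 - 3 * 0)\<^sup>2 - real K * (32 * 0 + 80 * 0\<^sup>2)) / (228 * (2 + 0)\<^sup>2)"
    by (intro tendsto_intros lim_inverse_n) auto
  moreover have "eventually (\<lambda>n. (48 * (2 - 3 * inverse (real n))\<^sup>2
      - real K * (32 * inverse (real n) + 80 * (inverse (real n))\<^sup>2)) / (228 * (2 + inverse (real n))\<^sup>2)
      = ?g n) sequentially"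
  proof (rule eventually_sequentiallyI)
    fix n :: nat
    assume "1 \<le> n"
    then have n: "real n \<noteq> 0"
      by simp
    have "(48 * (2 - 3 * inverse (real n))\<^sup>2 - real K * (32 * inverse (real n) + 80 * (inverse (real n))\<^sup>2))
        / (228 * (2 + inverse (real n))\<^sup>2)
      = ((real n)\<^sup>2 * (48 * (2 - 3 * inverse (real n))\<^sup>2
          - real K * (32 * inverse (real n) + 80 * (inverse (real n))\<^sup>2)))
        / ((real n)\<^sup>2 * (228 * (2 + inverse (real n))\<^sup>2))"
      using n by simp
    also have "(real n)\<^sup>2 * (48 * (2 - 3 * inverse (real n))\<^sup>2
          - real K * (32 * inverse (real n) + 80 * (inverse (real n))\<^sup>2))
        = 48 * (2 * real n - 3)\<^sup>2 - real K * ((2 * real n + 9)\<^sup>2 - (2 * real n + 1)\<^sup>2)"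
      using n by (simp add: field_simps power2_eq_square)
    also have "(real n)\<^sup>2 * (228 * (2 + inverse (real n))\<^sup>2) = 228 * (2 * real n + 1)\<^sup>2"
      using n by (simp add: field_simps power2_eq_square)
    finally show "(48 * (2 - 3 * inverse (real n))\<^sup>2
      - real K * (32 * inverse (real n) + 80 * (inverse (real n))\<^sup>2)) / (228 * (2 + inverse (real n))\<^sup>2)
      = ?g n" .
  qed
  ultimately have "?g \<longlonglongrightarrow> 4 / 19"
    by (auto elim!: Lim_transform_eventually)
  then have "limsup (\<lambda>n. ereal (?g n)) = ereal (4 / 19)"
    by (intro lim_imp_Limsup) (auto intro: tendsto_ereal)
  then show ?thesis
    unfolding code_density_def using Limsup_mono[OF le] by simp
qed

subsection \<open>The vertices around a codeword\<close>

text \<open>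
  The vertices at distance 1 to 4 from a codeword; the codeword itself has no name. The type
  \<open>center\<close> names the ten vertices at distance at most 2, in their role as centers of balls, and
  \<open>ball\<close> lists the other vertices of such a ball, without the codeword.
\<close>

datatype site =
    X1 | X2 | X3 | X4 | X5 | X6 | X7 | X8 | X9 | X10 | X11 | X12 | X13 | X14 | X15 | X16 | X17 | X18
    | X19 | X20 | X21 | X22 | X23 | X24 | X25 | X26 | X27 | X28 | X29 | X30

primrec pos :: "site \<Rightarrow> int \<times> int" where
  "pos X1 = (-1, 0)" | "pos X2 = (1, 0)" | "pos X3 = (0, 1)" | "pos X4 = (-2, 0)" |
  "pos X5 = (-1, -1)" | "pos X6 = (2, 0)" | "pos X7 = (1, -1)" | "pos X8 = (-1, 1)" |
  "pos X9 = (1, 1)" | "pos X10 = (-3, 0)" | "pos X11 = (-2, 1)" | "pos X12 = (-2, -1)" |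
  "pos X13 = (0, -1)" | "pos X14 = (3, 0)" | "pos X15 = (2, 1)" | "pos X16 = (2, -1)" |
  "pos X17 = (-1, 2)" | "pos X18 = (1, 2)" | "pos X19 = (-4, 0)" | "pos X20 = (-3, -1)" |
  "pos X21 = (-3, 1)" | "pos X22 = (-2, -2)" | "pos X23 = (0, -2)" | "pos X24 = (4, 0)" |
  "pos X25 = (3, -1)" | "pos X26 = (3, 1)" | "pos X27 = (2, -2)" | "pos X28 = (-2, 2)" |
  "pos X29 = (0, 2)" | "pos X30 = (2, 2)"

datatype center = U0 | U1 | U2 | U3 | U4 | U5 | U6 | U7 | U8 | U9

primrec center_pos :: "center \<Rightarrow> int \<times> int" where
  "center_pos U0 = (0, 0)" | "center_pos U1 = (-1, 0)" | "center_pos U2 = (1, 0)" |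
  "center_pos U3 = (0, 1)" | "center_pos U4 = (-2, 0)" | "center_pos U5 = (-1, -1)" |
  "center_pos U6 = (2, 0)" | "center_pos U7 = (1, -1)" | "center_pos U8 = (-1, 1)" |
  "center_pos U9 = (1, 1)"

primrec ball :: "center \<Rightarrow> site list" where
  "ball U0 = [X1, X2, X3, X4, X5, X6, X7, X8, X9]"
| "ball U1 = [X1, X2, X3, X4, X5, X10, X11, X12, X13]"
| "ball U2 = [X1, X2, X3, X6, X7, X13, X14, X15, X16]"
| "ball U3 = [X1, X2, X3, X8, X9, X11, X15, X17, X18]"
| "ball U4 = [X1, X4, X5, X8, X10, X11, X19, X20, X21]"
| "ball U5 = [X1, X4, X5, X7, X12, X13, X20, X22, X23]"
| "ball U6 = [X2, X6, X7, X9, X14, X15, X24, X25, X26]"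
| "ball U7 = [X2, X5, X6, X7, X13, X16, X23, X25, X27]"
| "ball U8 = [X3, X4, X8, X9, X11, X17, X21, X28, X29]"
| "ball U9 = [X3, X6, X8, X9, X15, X18, X26, X29, X30]"

text \<open>The rotation of the honeycomb by a third of a turn around the codeword. In the
  coordinates \<open>pos\<close> it is not linear, hence the table.\<close>

primrec rot :: "site \<Rightarrow> site" where
  "rot X1 = X2" | "rot X2 = X3" | "rot X3 = X1" | "rot X4 = X7" | "rot X5 = X6" | "rot X6 = X8" |
  "rot X7 = X9" | "rot X8 = X5" | "rot X9 = X4" | "rot X10 = X16" | "rot X11 = X13" |
  "rot X12 = X14" | "rot X13 = X15" | "rot X14 = X17" | "rot X15 = X11" | "rot X16 = X18" |
  "rot X17 = X12" | "rot X18 = X10" | "rot X19 = X27" | "rot X20 = X25" | "rot X21 = X23" |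
  "rot X22 = X24" | "rot X23 = X26" | "rot X24 = X28" | "rot X25 = X29" | "rot X26 = X21" |
  "rot X27 = X30" | "rot X28 = X22" | "rot X29 = X20" | "rot X30 = X19"

text \<open>The reflection that negates the first coordinate. With \<open>rot\<close> it generates
  the six symmetries fixing the codeword.\<close>

primrec ref :: "site \<Rightarrow> site" where
  "ref X1 = X2" | "ref X2 = X1" | "ref X3 = X3" | "ref X4 = X6" | "ref X5 = X7" | "ref X6 = X4" |
  "ref X7 = X5" | "ref X8 = X9" | "ref X9 = X8" | "ref X10 = X14" | "ref X11 = X15" |
  "ref X12 = X16" | "ref X13 = X13" | "ref X14 = X10" | "ref X15 = X11" | "ref X16 = X12" |
  "ref X17 = X18" | "ref X18 = X17" | "ref X19 = X24" | "ref X20 = X25" | "ref X21 = X26" |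
  "ref X22 = X27" | "ref X23 = X23" | "ref X24 = X19" | "ref X25 = X20" | "ref X26 = X21" |
  "ref X27 = X22" | "ref X28 = X30" | "ref X29 = X29" | "ref X30 = X28"

text \<open>
  Partial knowledge about the code. All data of the checker below are built from constructors of
  small arity, and amounts are unary, because the certificate is evaluated by rewriting.
\<close>

datatype mark = Unknown | Yes | No

datatype row = Row (c1: mark) (c2: mark) (c3: mark) (c4: mark) (c5: mark) (c6: mark)

datatype marks = Marks row row row row row

fun look :: "site \<Rightarrow> marks \<Rightarrow> mark" where
  "look X1 (Marks a b c d e) = c1 a" | "look X2 (Marks a b c d e) = c2 a" |
  "look X3 (Marks a b c d e) = c3 a" | "look X4 (Marks a b c d e) = c4 a" |
  "look X5 (Marks a b c d e) = c5 a" | "look X6 (Marks a b c d e) = c6 a" |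
  "look X7 (Marks a b c d e) = c1 b" | "look X8 (Marks a b c d e) = c2 b" |
  "look X9 (Marks a b c d e) = c3 b" | "look X10 (Marks a b c d e) = c4 b" |
  "look X11 (Marks a b c d e) = c5 b" | "look X12 (Marks a b c d e) = c6 b" |
  "look X13 (Marks a b c d e) = c1 c" | "look X14 (Marks a b c d e) = c2 c" |
  "look X15 (Marks a b c d e) = c3 c" | "look X16 (Marks a b c d e) = c4 c" |
  "look X17 (Marks a b c d e) = c5 c" | "look X18 (Marks a b c d e) = c6 c" |
  "look X19 (Marks a b c d e) = c1 d" | "look X20 (Marks a b c d e) = c2 d" |
  "look X21 (Marks a b c d e) = c3 d" | "look X22 (Marks a b c d e) = c4 d" |
  "look X23 (Marks a b c d e) = c5 d" | "look X24 (Marks a b c d e) = c6 d" |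
  "look X25 (Marks a b c d e) = c1 e" | "look X26 (Marks a b c d e) = c2 e" |
  "look X27 (Marks a b c d e) = c3 e" | "look X28 (Marks a b c d e) = c4 e" |
  "look X29 (Marks a b c d e) = c5 e" | "look X30 (Marks a b c d e) = c6 e"

fun put1 :: "mark \<Rightarrow> row \<Rightarrow> row" where
  "put1 y (Row a1 a2 a3 a4 a5 a6) = Row y a2 a3 a4 a5 a6"

fun put2 :: "mark \<Rightarrow> row \<Rightarrow> row" where
  "put2 y (Row a1 a2 a3 a4 a5 a6) = Row a1 y a3 a4 a5 a6"

fun put3 :: "mark \<Rightarrow> row \<Rightarrow> row" where
  "put3 y (Row a1 a2 a3 a4 a5 a6) = Row a1 a2 y a4 a5 a6"

fun put4 :: "mark \<Rightarrow> row \<Rightarrow> row" where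
  "put4 y (Row a1 a2 a3 a4 a5 a6) = Row a1 a2 a3 y a5 a6"

fun put5 :: "mark \<Rightarrow> row \<Rightarrow> row" where
  "put5 y (Row a1 a2 a3 a4 a5 a6) = Row a1 a2 a3 a4 y a6"

fun put6 :: "mark \<Rightarrow> row \<Rightarrow> row" where
  "put6 y (Row a1 a2 a3 a4 a5 a6) = Row a1 a2 a3 a4 a5 y"

fun upd :: "site \<Rightarrow> mark \<Rightarrow> marks \<Rightarrow> marks" where
  "upd X1 y (Marks a b c d e) = Marks (put1 y a) b c d e" |
  "upd X2 y (Marks a b c d e) = Marks (put2 y a) b c d e" |
  "upd X3 y (Marks a b c d e) = Marks (put3 y a) b c d e" |
  "upd X4 y (Marks a b c d e) = Marks (put4 y a) b c d e" |
  "upd X5 y (Marks a b c d e) = Marks (put5 y a) b c d e" |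
  "upd X6 y (Marks a b c d e) = Marks (put6 y a) b c d e" |
  "upd X7 y (Marks a b c d e) = Marks a (put1 y b) c d e" |
  "upd X8 y (Marks a b c d e) = Marks a (put2 y b) c d e" |
  "upd X9 y (Marks a b c d e) = Marks a (put3 y b) c d e" |
  "upd X10 y (Marks a b c d e) = Marks a (put4 y b) c d e" |
  "upd X11 y (Marks a b c d e) = Marks a (put5 y b) c d e" |
  "upd X12 y (Marks a b c d e) = Marks a (put6 y b) c d e" |
  "upd X13 y (Marks a b c d e) = Marks a b (put1 y c) d e" |
  "upd X14 y (Marks a b c d e) = Marks a b (put2 y c) d e" |
  "upd X15 y (Marks a b c d e) = Marks a b (put3 y c) d e" |
  "upd X16 y (Marks a b c d e) = Marks a b (put4 y c) d e" |
  "upd X17 y (Marks a b c d e) = Marks a b (put5 y c) d e" |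
  "upd X18 y (Marks a b c d e) = Marks a b (put6 y c) d e" |
  "upd X19 y (Marks a b c d e) = Marks a b c (put1 y d) e" |
  "upd X20 y (Marks a b c d e) = Marks a b c (put2 y d) e" |
  "upd X21 y (Marks a b c d e) = Marks a b c (put3 y d) e" |
  "upd X22 y (Marks a b c d e) = Marks a b c (put4 y d) e" |
  "upd X23 y (Marks a b c d e) = Marks a b c (put5 y d) e" |
  "upd X24 y (Marks a b c d e) = Marks a b c (put6 y d) e" |
  "upd X25 y (Marks a b c d e) = Marks a b c d (put1 y e)" |
  "upd X26 y (Marks a b c d e) = Marks a b c d (put2 y e)" |
  "upd X27 y (Marks a b c d e) = Marks a b c d (put3 y e)" |
  "upd X28 y (Marks a b c d e) = Marks a b c d (put4 y e)" |
  "upd X29 y (Marks a b c d e) = Marks a b c d (put5 y e)" |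
  "upd X30 y (Marks a b c d e) = Marks a b c d (put6 y e)"

text \<open>Marks are pulled back: the new mark at \<open>x\<close> is the old one at
  \<open>rot x\<close>. So the result describes \<open>Q \<circ> rot\<close> if the argument
  describes \<open>Q\<close>.\<close>

fun rot_marks :: "marks \<Rightarrow> marks" where
  "rot_marks (Marks (Row a1 a2 a3 a4 a5 a6) (Row a7 a8 a9 a10 a11 a12) (Row a13 a14 a15 a16 a17 a18)
  (Row a19 a20 a21 a22 a23 a24) (Row a25 a26 a27 a28 a29 a30)) = Marks (Row a2 a3 a1 a7 a6 a8)
  (Row a9 a5 a4 a16 a13 a14) (Row a15 a17 a11 a18 a12 a10) (Row a27 a25 a23 a24 a26 a28)
  (Row a29 a21 a30 a22 a20 a19)"

fun ref_marks :: "marks \<Rightarrow> marks" where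
  "ref_marks (Marks (Row a1 a2 a3 a4 a5 a6) (Row a7 a8 a9 a10 a11 a12) (Row a13 a14 a15 a16 a17 a18)
  (Row a19 a20 a21 a22 a23 a24) (Row a25 a26 a27 a28 a29 a30)) = Marks (Row a2 a1 a3 a6 a7 a4)
  (Row a5 a9 a8 a14 a15 a16) (Row a13 a10 a11 a12 a18 a17) (Row a24 a25 a26 a27 a23 a19)
  (Row a20 a21 a22 a30 a29 a28)"

definition blank :: marks where
  "blank = (let r = Row Unknown Unknown Unknown Unknown Unknown Unknown in Marks r r r r r)"

subsection \<open>The rules\<close>

abbreviation four :: "nat \<Rightarrow> nat" where
  "four n \<equiv> Suc (Suc (Suc (Suc n)))"

text \<open>
  In \<open>(a, p, q, ls)\<close> the amount \<open>a\<close> is in units of \<open>1/48\<close>, \<open>p\<close> is the receiver as seen from the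
  sender, and \<open>q\<close> is the sender as seen from the receiver. An entry \<open>(b, x, y)\<close> of \<open>ls\<close> demands that
  a vertex, which is \<open>x\<close> for the sender and \<open>y\<close> for the receiver, is a codeword iff \<open>b\<close>. Each rule is
  also applied after the six symmetries generated by \<open>rot\<close> and \<open>ref\<close>.
\<close>

type_synonym rule = "nat \<times> site \<times> site \<times> (bool \<times> site \<times> site) list"

definition rules :: "rule list" where
  "rules = [
    (Suc (Suc (four 0)), X1, X1, [(False, X6, X10), (False, X9, X12), (False, X7, X11),
    (False, X11, X7), (False, X8, X13), (False, X12, X9), (False, X13, X8), (False, X3, X5)]),
    (four 0, X4, X6, [(True, X19, X4), (False, X10, X1), (False, X6, X24), (False, X7, X25),
    (False, X2, X14)]),
    (Suc (four 0), X4, X6, [(True, X12, X13), (False, X1, X2), (False, X11, X3), (False, X5, X7),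
    (False, X7, X25), (False, X6, X24), (False, X8, X9), (False, X9, X26)]),
    (Suc (Suc 0), X10, X10, [(False, X5, X11), (False, X8, X12), (False, X1, X4), (False, X11, X5),
    (False, X13, X21), (False, X12, X8), (False, X3, X20), (False, X2, X19)]),
    (Suc (four 0), X10, X10, [(True, X12, X8), (False, X19, X2), (False, X11, X5), (False, X1, X4),
    (False, X22, X17), (False, X5, X11), (False, X13, X21), (False, X8, X12)]),
    (Suc (Suc 0), X11, X11, [(False, X21, X2), (False, X4, X3), (False, X15, X19), (False, X9, X10),
    (False, X2, X21), (False, X5, X17), (False, X12, X29), (False, X8, X1), (False, X17, X5),
    (False, X1, X8), (False, X3, X4), (False, X10, X9)]),
    (Suc (Suc 0), X11, X11, [(False, X19, X15), (False, X28, X13), (False, X21, X2),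
    (False, X29, X12), (False, X4, X3), (False, X8, X1), (False, X5, X17), (False, X9, X10),
    (False, X10, X9), (False, X17, X5), (False, X15, X19), (False, X1, X8), (False, X3, X4),
    (False, X12, X29)]),
    (four (four 0), X19, X24, [(True, X10, X2), (False, X1, X14), (False, X8, X26),
    (False, X11, X15), (False, X5, X25)]),
    (four (four 0), X20, X26, [(True, X10, X3), (False, X11, X18), (False, X1, X15),
    (False, X5, X6), (False, X13, X14), (False, X4, X9)]),
    (Suc (Suc 0), X21, X25, [(True, X10, X13), (False, X11, X2), (False, X3, X14), (False, X19, X5),
    (False, X4, X7), (False, X8, X6), (False, X1, X16), (False, X20, X23)])]"

subsection \<open>A checker for case distinctions\<close>

text \<open>Under partial knowledge, \<open>certain\<close> bounds the truth of a condition from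
  below and \<open>possible\<close> bounds it from above. The former is used for weight sent, the
  latter for weight received.\<close>

fun certain :: "bool \<Rightarrow> mark \<Rightarrow> bool" where
  "certain b Unknown = False"
| "certain b Yes = b"
| "certain b No = (\<not> b)"

fun possible :: "bool \<Rightarrow> mark \<Rightarrow> bool" where
  "possible b Unknown = True"
| "possible b Yes = b"
| "possible b No = (\<not> b)"

text \<open>Sending is judged from the sender, hence at \<open>x\<close>;
  \<open>all_possible\<close> takes the view of the receiver and reads \<open>y\<close>.\<close>

fun all_certain :: "(bool \<times> site \<times> site) list \<Rightarrow> marks \<Rightarrow> bool" where
  "all_certain [] s = True"
| "all_certain ((b, x, y) # ls) s = (certain b (look x s) \<and> all_certain ls s)"

fun all_possible :: "(bool \<times> site \<times> site) list \<Rightarrow> marks \<Rightarrow> bool" where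
  "all_possible [] s = True"
| "all_possible ((b, x, y) # ls) s = (possible b (look y s) \<and> all_possible ls s)"

fun add_if :: "bool \<Rightarrow> nat \<Rightarrow> nat \<Rightarrow> nat" where
  "add_if True a n = a + n"
| "add_if False a n = n"

fun sure_outflow :: "rule list \<Rightarrow> marks \<Rightarrow> nat" where
  "sure_outflow [] s = 0"
| "sure_outflow ((a, p, q, ls) # rs) s =
     add_if (certain True (look p s) \<and> all_certain ls s) a (sure_outflow rs s)"

fun max_inflow :: "rule list \<Rightarrow> marks \<Rightarrow> nat" where
  "max_inflow [] s = 0"
| "max_inflow ((a, p, q, ls) # rs) s =
     add_if (possible True (look q s) \<and> all_possible ls s) a (max_inflow rs s)"

primrec sum_over :: "(marks \<Rightarrow> nat) \<Rightarrow> marks list \<Rightarrow> nat" where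
  "sum_over f [] = 0"
| "sum_over f (s # ss) = f s + sum_over f ss"

definition orbit :: "marks \<Rightarrow> marks list" where
  "orbit s = [s, rot_marks s, rot_marks (rot_marks s),
     ref_marks s, rot_marks (ref_marks s), rot_marks (rot_marks (ref_marks s))]"

fun count_mark :: "mark \<Rightarrow> nat \<Rightarrow> nat" where
  "count_mark Yes n = Suc n"
| "count_mark No n = n"
| "count_mark Unknown n = n"

primrec count_yes :: "site list \<Rightarrow> marks \<Rightarrow> nat" where
  "count_yes [] s = 0"
| "count_yes (x # xs) s = count_mark (look x s) (count_yes xs s)"

text \<open>
  What a vertex gives to the codeword if it sees at least \<open>n\<close> other codewords, as the difference
  to \<open>24\<close>, the amount for \<open>n = 1\<close>.
\<close>

fun drop_of :: "nat \<Rightarrow> nat" where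
  "drop_of 0 = 0"
| "drop_of (Suc 0) = 0"
| "drop_of (Suc (Suc 0)) = four (four 0)"
| "drop_of (Suc (Suc (Suc n))) = four (four (four 0))"

primrec drops :: "nat list \<Rightarrow> nat" where
  "drops [] = 0"
| "drops (n # ns) = drop_of n + drops ns"

fun is_zero :: "nat \<Rightarrow> bool" where
  "is_zero 0 = True"
| "is_zero (Suc n) = False"

text \<open>Applied to counts of known codewords, this signals that some center might see no other
  codeword, so that the extra \<open>24\<close> has to be reckoned with.\<close>

primrec some_zero :: "nat list \<Rightarrow> bool" where
  "some_zero [] = False"
| "some_zero (n # ns) = (is_zero n \<or> some_zero ns)"

fun le_unary :: "nat \<Rightarrow> nat \<Rightarrow> bool" where
  "le_unary 0 n = True"
| "le_unary (Suc m) 0 = False"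
| "le_unary (Suc m) (Suc n) = le_unary m n"

primrec counts :: "site list list \<Rightarrow> marks \<Rightarrow> nat list" where
  "counts [] s = []"
| "counts (b # bs) s = count_yes b s # counts bs s"

text \<open>
  Ten vertices giving \<open>24\<close> each exceed the allowed \<open>228 = 48 * 19 / 4\<close> by \<open>12\<close>; at most one vertex can
  see no other codeword, and it gives \<open>48\<close> instead of \<open>24\<close>.
\<close>

definition settled_with :: "rule list \<Rightarrow> marks list \<Rightarrow> nat list \<Rightarrow> bool" where
  "settled_with rs ss ns =
     le_unary (add_if (some_zero ns) (four (four (four (four (four (four 0))))))
         (four (four (four (sum_over (max_inflow rs) ss)))))
       (drops ns + sum_over (sure_outflow rs) ss)"

definition centers :: "center list" where
  "centers = [U0, U1, U2, U3, U4, U5, U6, U7, U8, U9]"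

definition balls :: "site list list" where
  "balls = map ball centers"

definition settled :: "marks \<Rightarrow> bool" where
  "settled s = settled_with rules (orbit s) (counts balls s)"

text \<open>One of these vertices is a codeword since \<open>u\<close> and \<open>v\<close> see different codewords.\<close>

definition sep :: "center \<Rightarrow> center \<Rightarrow> site list" where
  "sep u v = filter (\<lambda>x. x \<notin> set (ball v)) (ball u) @ filter (\<lambda>x. x \<notin> set (ball u)) (ball v)"

text \<open>\<open>k\<close> treats the remaining sites of the clause. If \<open>x\<close> is known
  to be a codeword, the clause holds already and the distinction is rejected as pointless; a known
  non-codeword is skipped without consuming a subtree.\<close>

fun branch :: "mark \<Rightarrow> site \<Rightarrow> ((marks \<Rightarrow> bool) list \<Rightarrow> marks \<Rightarrow> bool) \<Rightarrow>
    (marks \<Rightarrow> bool) list \<Rightarrow> marks \<Rightarrow> bool" where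
  "branch Yes x k fs s = False"
| "branch No x k fs s = k fs s"
| "branch Unknown x k [] s = (settled (upd x Yes s) \<and> k [] (upd x No s))"
| "branch Unknown x k (f # fs) s = (f (upd x Yes s) \<and> k fs (upd x No s))"

text \<open>At the end of the clause all its sites are non-codewords, contrary to separation; hence
  \<open>True\<close>.\<close>

primrec clause_check :: "site list \<Rightarrow> (marks \<Rightarrow> bool) list \<Rightarrow> marks \<Rightarrow> bool" where
  "clause_check [] fs s = True"
| "clause_check (x # xs) fs s = branch (look x s) x (clause_check xs) fs s"

text \<open>
  \<open>V x\<close> branches on \<open>x\<close> being a codeword; \<open>K u v\<close> branches on the first codeword of \<open>sep u v\<close>,
  where missing subtrees at the end of the list stand for \<open>L\<close>.
\<close>

datatype tree = L | V site tree tree | K center center "tree list"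

primrec check :: "tree \<Rightarrow> marks \<Rightarrow> bool" where
  "check L s = settled s"
| "check (V x t t') s = (check t (upd x Yes s) \<and> check t' (upd x No s))"
| "check (K u v ts) s = (u \<noteq> v \<and> clause_check (sep u v) (map check ts) s)"

text \<open>The root asks for the first codeword of \<open>sep U0 U2\<close>. A node
  \<open>K u v []\<close> either settles all its branches directly or refutes the case, namely when
  every site of \<open>sep u v\<close> is already excluded.\<close>

definition cert :: tree where
  "cert =
  K U0 U2 [V X2 (V X1 (V X3 (V X26 (V X16 L L) (V X23 L (V X24 L L))) (V X23 (V X26 L (V X5 L (V X7 L (V
  X14 L (V X15 L (V X18 L (V X24 (V X19 L L) (V X19 L L)))))))) (K U0 U1 [L,V X26 L L,L,L,V X26 L (V
  X16 L (V X14 L (K U2 U3 []))),V X26 L (V X16 L L),V X26 L (V X14 L (K U2 U3 []))]))) (V X3 (V X26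
  (V X5 L L) (V X6 L (V X9 L (V X23 L (V X24 L L))))) (K U2 U3 [V X5 L (V X23 L (V X24 L L)),V X9 L (V
  X26 L (V X13 L (V X27 L L))),V X9 L (V X26 L (V X14 L (V X15 L (V X24 L L)))),V X9 L (V X23 (V X15 L
  L) (V X15 L (V X18 L (V X27 (V X5 L (V X8 L (K U0 U1 []))) (V X5 L (V X8 L (K U0 U1 []))))))),V X5
  (V X9 L (V X15 L L)) (V X26 L (V X15 L (V X18 L (K U2 U7 [L,L,V X24 L L])))),V X5 L L,L,V X26 L
  (K U2 U6 [V X23 L (V X15 L (V X27 L L))]),K U0 U1 [V X26 L (K U2 U6 [V X23 L (V X27 L L)]),V X26 L
  (K U2 U6 [V X27 L L])],K U0 U1 [V X23 L L]]))) (V X1 (V X3 (K U0 U1 [L,L,V X23 L L,L,V X26 L (V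
  X23 L (V X13 L L)),V X13 L L,V X26 L (V X19 L L),V X26 L (V X14 L L)]) (K U0 U1 [V X7 L (V X23 L (V
  X19 L L)),V X9 L (V X8 L (V X17 L (V X19 (V X15 L (V X18 L L)) L))),V X23 L (V X16 L (V X22 L L)),V
  X5 L (V X23 L (V X11 L (V X19 L L))),V X23 (V X15 L (V X14 L (V X18 L L))) (V X16 (V X5 L (V X15 L
  L)) (V X15 L (V X13 L (V X22 (V X14 L (V X18 L L)) L)))),V X23 L (V X5 L L),V X17 (V X13 L L) (V X15
  L (K U0 U4 [V X13 L L])),V X17 L (V X19 L L)])) (V X3 (V X6 (V X17 L (V X18 L L)) (V X7 (V X26 L (V
  X5 L L)) (V X9 (V X14 L (V X5 L (V X30 (V X13 L (V X16 L L)) L))) (V X26 (K U2 U3 [L,V X17 L L,L,L,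
  L,K U0 U1 []]) (K U3 U9 [V X30 L L,V X25 L (K U0 U1 [L,L,V X5 L L]),V X25 L (V X14 L (V X16 L
  L)),V X25 L (K U0 U8 [L,V X14 L (V X16 L L),K U0 U1 [L,V X14 L (K U2 U3 []),V X14 L (V X16 L
  L)]])]))))) (V X6 (V X13 (V X8 L (V X9 L (V X17 L (V X18 L (V X5 L (V X7 L (V X10 L (V X11 L (V X14 L
  (V X15 L (V X19 L (K U4 U8 [L,K U1 U5 [K U2 U7 []]])))))))))))) (V X8 L (V X9 L (V X17 (K U1 U4 [])
  (V X18 (K U1 U4 []) (V X5 L (V X7 L (V X11 L (V X15 L (K U1 U4 [V X14 L (K U2 U7 [K U2 U6 [],L,K
  U2 U6 []]),V X10 (V X14 L (K U2 U7 [])) (V X14 (K U1 U5 []) (K U2 U7 [K U1 U8 [],K U1 U5 [],K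
  U1 U5 [K U2 U6 [],K U2 U6 []]])),K U2 U6 [L,V X10 L (K U4 U5 [])],V X14 L (K U2 U7 [K U4 U8
  [],L,K U2 U6 []])])))))))))) (V X9 (V X7 (V X5 L L) (V X5 (V X11 L (V X14 L (V X16 L L))) (V X13 L
  (V X11 (V X14 L L) (V X16 L (V X8 L (V X15 L (V X14 (V X18 L (V X23 L (V X25 L (V X26 L (V X27 L (K U1
  U5 [V X12 L L,K U3 U9 [],K U1 U4 []])))))) (V X10 (V X12 L (K U1 U4 [])) (V X12 (K U1 U5 []) (K
  U1 U4 [K U1 U5 [],K U4 U5 [],K U1 U5 []]))))))))))) (V X7 (V X8 L (V X15 L (V X13 (V X17 L L) (V
  X18 L (V X5 L (V X11 L (V X17 (V X10 L (V X21 L (V X26 L (V X29 L (V X30 L (K U2 U6 [V X14 L L,K U2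
  U7 [],K U1 U4 []])))))) (V X10 (V X12 L (K U1 U4 [])) (V X14 (V X12 L (K U1 U4 [])) (V X16 (K U2
  U7 []) (K U2 U7 [K U2 U6 [],K U0 U5 [],K U2 U6 []]))))))))))) (K U0 U1 [V X5 L (V X11 L (V X13
  (V X14 L L) (V X15 L (V X12 L (V X18 L (V X10 (V X17 L (K U0 U8 [])) (V X17 (K U0 U4 []) (V X20 (K
  U0 U8 []) (K U1 U5 [K U0 U4 [],K U0 U4 []]))))))))),V X13 (V X15 L (V X5 L (V X16 L (V X21 (V X14
  L L) (V X14 (V X18 L (V X11 L (K U0 U8 []))) (V X23 (V X11 L (K U0 U8 [])) (K U2 U7 [V X18 L (V X11
  L (K U0 U8 [])),V X11 L (K U0 U8 [])]))))))) (V X5 (V X15 L (V X16 L L)) (V X15 (K U2 U6 [L,K U2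
  U3 [V X29 L L],L,K U2 U3 []]) (V X11 (V X17 L (V X23 L (V X18 (V X14 L L) (K U0 U5 [])))) (V X12
  (V X17 L (K U0 U8 [L,V X14 L L])) (K U1 U4 [V X17 (V X14 L L) (V X23 (V X18 L L) (K U0 U5 [K U0 U8
  [],K U0 U8 []])),V X17 (V X14 L L) (V X29 (V X14 L L) (K U0 U8 [K U3 U9 [L,V X14 L L],K U3 U9
  [L,V X14 L L]])),K U0 U5 [V X17 L (V X23 L (V X25 L (V X26 L (K U3 U9 [L,K U2 U6 []])))),V X14 (V
  X16 L L) L]]))))),V X5 (V X15 L L) (V X13 (V X15 L (V X16 L (V X17 L (V X19 L (V X20 L (V X21 L (V
  X23 L (V X26 L (V X14 (K U4 U8 []) (K U2 U7 [K U4 U8 []])))))))))) (V X15 (V X16 L (K U2 U6 [V X25 L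
  L])) (V X17 (V X12 L (K U1 U4 [])) (V X18 (V X12 L (K U0 U5 [L,K U1 U4 []])) (V X12 (V X19 L (K U4
  U8 [])) (V X20 (K U1 U8 []) (K U0 U5 [K U1 U4 [],K U1 U4 []]))))))),K U0 U4 [V X5 (V X15 L L) (V
  X17 (V X15 (V X25 L L) (V X13 L (K U1 U5 []))) (V X15 (K U2 U3 []) (V X21 L (K U0 U8 [K U1 U5 [],V
  X13 L L])))),V X5 (V X15 L (V X17 L L)) (V X17 (V X15 (V X25 L L) (V X13 L (V X18 L (V X21 L (V X25 L
  (V X28 L (V X29 L (V X14 (V X16 L L) (K U2 U7 []))))))))) (V X15 (K U2 U3 []) (V X21 L (K U0 U8 [V
  X13 L (V X14 L L),V X13 L L])))),V X5 L (V X15 (K U1 U5 [V X25 L (V X16 L (K U2 U6 []))]) (K U1 U5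
  [K U4 U8 []]))],V X15 (K U0 U4 []) (K U0 U4 [V X5 L (V X16 L (V X17 (V X14 L (K U2 U7 [])) (V X23
  L (K U1 U5 [K U2 U7 [],V X14 L (K U2 U7 [])])))),V X5 L (V X16 L (V X17 (V X14 L (K U2 U7 [])) (V
  X14 (K U0 U8 []) (V X21 L (K U0 U8 [K U2 U7 [],V X25 L L]))))),K U1 U5 [V X14 L (V X25 L (K U2 U7
  []))]])])))))),V X3 (V X1 (V X2 (V X26 (V X17 L L) (V X21 L (V X24 L L))) (V X21 (V X26 L (V X7 L (V
  X14 L (V X15 L (V X18 L (V X30 (V X22 L L) (V X22 L L))))))) (V X26 L (K U0 U1 [L,L,L,L,V X14 L (V
  X15 L (V X28 L (V X17 L L))),L,V X14 L (V X13 L (V X28 L L)),V X14 L L])))) (V X2 (V X26 L (V X9 L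
  (V X21 L (V X18 L (V X24 L L))))) (K U2 U3 [V X21 L (V X7 L L),V X21 L (V X8 L L),K U3 U9 [V X9 L L,
  V X9 L L,L,L,V X21 L (V X14 L (V X28 L L))],K U3 U9 [L,L,L,L,V X21 L (V X9 L (V X28 L L))],K
  U3 U9 [V X9 L L,V X26 L (V X9 L L),V X21 L L,V X21 L L,V X21 (V X8 L (K U0 U1 [])) (K U3 U8 [L,
  L,K U0 U1 []])],V X26 L (V X11 L (V X30 L L)),V X21 L L,V X26 L (K U2 U9 []),V X26 L (K U0 U1
  [L,V X30 L L]),K U0 U1 [L,V X21 L (V X28 L L)]]))) (V X1 (V X2 (K U0 U1 [V X21 L L,V X21 L (V X26
  L L),L,L,V X26 L (V X24 L L),V X24 L (V X14 L L),V X26 L (V X21 L L)]) (K U0 U1 [V X8 L (V X21 L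
  (V X13 L (V X22 L L))),V X9 L (V X8 L (V X21 L (V X19 L L))),V X16 L (V X9 L (V X22 (V X14 L (V X15
  L L)) L)),V X21 L (V X11 L L),V X16 (V X11 L L) (V X15 L (V X17 L (V X18 L (K U2 U3 [])))),V X16 L
  (V X15 L (V X14 L L)),V X21 (V X13 L (V X14 L L)) (V X13 L (K U0 U4 [V X15 L L])),V X21 L L])) (V X2
  (V X9 (V X27 L L) (V X8 (V X24 L L) (V X26 (K U2 U3 [L,L,L,V X27 L L,K U0 U1 []]) (K U2 U6 [V X18
  L (V X24 L L),V X29 L (V X6 L (K U0 U1 [])),V X6 (V X18 L (V X11 L (V X17 L L))) (V X29 L (K U0 U7
  [V X17 L (V X18 L L),L,K U0 U1 [L,V X17 L (V X18 L L),L,K U2 U3 []]])),V X18 L (V X29 L (V X17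
  L L))])))) (V X9 (V X11 (V X7 L (V X14 L (V X16 L (V X6 L (V X8 L (V X12 L (V X13 L (V X15 L (V X18 L
  (V X20 L (K U5 U7 [L,L,K U6 U9 []]))))))))))) (V X7 L (V X14 (K U1 U5 []) (V X16 (K U1 U5 []) (V
  X6 L (V X8 L (V X13 L (V X15 L (K U1 U5 [V X18 L (K U3 U8 [K U3 U6 [],K U3 U9 []]),K U3 U9 [L,L,
  L,K U3 U6 []],K U1 U4 [V X17 L (K U3 U9 []),K U3 U9 [L,L,L,K U3 U6 []],K U1 U7 []],V X18 L
  (K U3 U8 [K U5 U7 [],K U1 U4 [L,K U5 U7 []]])]))))))))) (V X8 (V X7 L (V X15 (V X6 L L) (V X6 L (V
  X11 (V X16 L L) (V X14 L (V X13 L (V X16 (V X12 L (V X23 L (V X24 L (V X25 L (V X26 L (K U3 U9 [V X18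
  L L,K U1 U5 [],K U3 U8 []])))))) (V X12 (V X10 L (K U0 U4 [])) (V X17 (V X18 L (K U3 U8 [])) (V
  X18 (K U3 U9 []) (K U3 U8 [K U3 U9 [],K U3 U9 [],K U8 U9 []]))))))))))) (V X6 (V X11 L (V X13 (V
  X18 L L) (V X17 L (V X7 L (V X15 L (V X18 (V X14 L (V X21 L (V X26 L (V X28 L (V X29 L (K U1 U4 [V X10
  L L,K U1 U5 [],K U4 U5 []])))))) (V X10 (V X12 L (K U1 U4 [])) (V X12 (K U1 U5 []) (K U1 U5 [V
  X14 L (V X16 L (K U2 U6 [])),K U1 U4 [],K U1 U4 []]))))))))) (K U0 U1 [V X13 L (V X11 (V X15 L L)
  (V X15 L (V X10 L (V X14 L (V X12 (V X16 L (K U2 U6 [])) (V X16 (K U1 U4 []) (V X20 (K U2 U6 []) (K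
  U1 U4 [K U0 U5 [],K U0 U5 []])))))))),V X13 (V X15 (V X11 L (V X17 L L)) (V X16 L (V X20 L (V X23
  L (V X11 (V X14 L (V X18 L (K U3 U8 []))) (V X14 L (V X12 L (K U5 U7 [])))))))) (V X11 (V X15 L (V
  X23 L (V X16 (K U0 U5 []) (K U0 U7 [K U0 U5 [],V X18 L (K U0 U5 [])])))) (V X16 (V X15 (V X17 L (K
  U3 U9 [])) (V X12 L (K U0 U5 [V X14 L (V X22 L (V X23 L (V X25 L (V X27 L (V X29 L (V X17 (V X18 L L)
  (K U3 U9 []))))))),K U1 U4 []]))) (V X15 (K U2 U3 [K U2 U6 [],L,V X25 L L]) (V X23 (V X12 L (V
  X20 L (K U1 U4 [V X14 L L]))) (K U0 U7 [K U0 U5 [],V X12 (K U2 U6 []) (K U0 U5 [K U2 U6 [],K U1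
  U4 []])]))))),V X15 (V X16 L (V X29 L L)) (V X16 (V X13 L (V X26 L (K U0 U5 [V X18 L (K U3 U8 []),
  V X18 L (K U3 U8 []),K U1 U4 [V X18 L (K U3 U8 [])],K U1 U4 []]))) (V X23 (V X18 L (K U3 U8 []))
  (K U0 U7 [V X17 L (V X20 L (V X21 L (V X26 L (V X18 (V X14 L L) (K U3 U8 [V X14 L L,V X14 L L]))))),
  K U0 U5 [V X18 L (K U3 U8 []),V X18 L (V X29 L L),K U1 U4 []],K U0 U5 [V X17 L (V X20 L (V X21 L
  (V X22 L (V X18 (K U2 U6 []) (K U3 U8 [K U2 U6 [],K U2 U6 []]))))),V X18 L (K U3 U8 []),K U1 U4
  [K U2 U6 []]]]))),V X13 (V X15 (K U0 U4 []) (V X16 L (V X21 L (K U0 U4 [V X14 L L,V X14 L L]))))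
  (V X15 (K U2 U3 [K U0 U4 [],K U3 U9 [],L,K U0 U4 []]) (K U1 U5 [V X16 (V X17 L L) (V X25 (V X17
  L L) (K U0 U7 [K U2 U6 [V X17 L L],K U2 U6 [V X17 L L]])),K U0 U4 [V X16 L (K U0 U7 []),V X14 (V
  X16 L L) L],K U0 U4 [V X16 L (V X21 L (V X25 L (K U2 U6 [V X17 L L]))),V X14 (V X16 L L) L]])),V
  X15 (V X17 L (K U3 U9 [])) (V X16 (K U0 U4 []) (V X14 (K U0 U4 [V X17 L L]) (V X20 (K U1 U7 []) (K
  U0 U4 [K U1 U5 [],K U1 U5 []]))))])))))),V X2 (V X3 (V X1 (V X23 (V X14 L L) (V X26 L (V X22 L
  L))) (V X26 (V X23 L (K U0 U3 [])) (K U0 U3 [L,L,V X23 L (V X14 L L),L,K U1 U2 [V X23 L (V X9 L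
  L)],V X23 L (K U1 U2 [])]))) (V X1 (V X23 L (V X7 L (V X26 L (V X22 L L)))) (K U1 U2 [K U2 U7 [V X23
  L (V X27 L (V X7 L L)),V X7 L L,V X24 L L,V X26 L L,V X26 (V X6 L (V X7 L (K U0 U3 []))) (K U2 U6
  [L,L,L,V X6 L (K U0 U3 [])])],K U2 U7 [V X7 L (V X23 L L),V X7 L L,L,L,V X26 L (V X12 L (V
  X24 L L))],K U2 U7 [V X7 L L,L,L,L,V X26 L (V X7 L (V X24 L L))],V X23 L (V X15 L (V X27 L L)),
  V X26 L L,V X23 L (V X9 L (K U1 U7 [L,L,V X15 L (K U0 U3 [])])),V X23 L (K U1 U7 []),V X26 L (K
  U0 U3 [V X24 L L,V X9 L L])]))) (V X3 (V X1 (K U0 U3 [L,L,V X12 L L,V X22 L (V X10 L L),K U1 U2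
  [],V X22 L L]) (K U0 U3 [V X10 L (V X7 L (V X28 (V X12 L (V X13 L L)) L)),V X26 L (V X10 L L),V
  X26 L (V X9 L L),V X10 L (V X13 L (V X12 L L)),V X26 (V X18 L (V X12 L L)) (V X13 L (V X18 L (V X14
  L (K U0 U9 [])))),V X10 L (V X28 L L)])) (V X1 (V X7 (V X10 L L) (V X13 (V X6 L (V X10 L (V X14 L
  L))) (V X23 (K U1 U2 [V X14 L (V X15 L (V X6 L (K U0 U3 []))),L,V X19 L L]) (K U1 U5 [V X15 L (K U0
  U3 [L,L,L,V X9 L L]),V X22 L L,V X14 L (V X15 L (V X16 L L)),V X25 L (V X6 L (K U0 U3 [V X16 L
  L,V X9 L (K U0 U4 [K U1 U2 []]),V X9 L (K U1 U2 [])]))])))) (V X7 (V X15 (V X10 L (V X12 L (V X6 L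
  (V X9 L (V X11 L (V X13 L (V X16 L (V X17 L (V X20 L (K U5 U7 [K U4 U8 []])))))))))) (V X10 (K U2 U7
  []) (V X12 (K U2 U7 []) (V X6 L (V X9 L (V X11 L (V X13 L (K U2 U7 [V X17 L (K U3 U9 [K U3 U4 [],
  L,K U3 U8 []]),V X17 L (K U3 U9 [V X16 L (V X18 L (K U3 U4 [])),L,K U3 U8 []]),K U3 U8 [L,L,
  K U3 U4 []],K U2 U5 [V X17 L (K U3 U9 []),K U2 U6 [],K U2 U6 [K U3 U4 []]]])))))))) (K U0 U3 [V
  X13 L (V X15 (V X10 L L) (V X12 L (V X9 L (V X11 L (V X10 (V X17 L (V X20 L (V X21 L (V X22 L (V X23 L
  (K U2 U7 [V X16 L L,K U3 U8 [],K U2 U6 []])))))) (V X14 (V X16 L (K U2 U6 [])) (V X16 (K U2 U7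
  []) (K U2 U6 [K U2 U7 [],K U6 U7 [],K U2 U7 []])))))))),V X9 (V X13 L L) (V X15 (V X13 L (V X10
  L (V X14 L (V X21 L (V X23 L (V X26 L (V X29 L (V X16 (V X12 L L) (K U2 U6 [V X12 L L,V X12 L
  L]))))))))) (V X13 (V X14 L (K U2 U7 [])) (V X10 (V X12 L (V X17 L (V X18 L (K U3 U8 [])))) (V X12
  (V X18 L (K U0 U9 [L,L,K U3 U8 []])) (V X18 (V X17 L (V X19 L (K U4 U8 []))) (V X29 (V X17 L (K U3
  U4 [])) (K U0 U9 [K U3 U8 [L,V X17 L L],K U3 U8 [L,V X17 L L]]))))))),V X13 (V X10 L (V X25 L L))
  (K U0 U8 [V X9 L (V X14 L (V X21 (V X16 L L) (V X28 (V X16 L L) (V X16 (V X12 L (K U0 U4 [])) (V X26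
  (K U0 U4 []) (K U2 U6 [K U0 U4 [L,V X12 L L],V X12 L (K U0 U4 [])])))))),V X16 L (V X25 L (K U2
  U6 [])),V X9 L (V X14 L (V X10 (V X16 L (K U2 U6 [])) (K U0 U4 [V X16 L (K U2 U6 []),K U3 U9
  []]))),V X9 L (V X14 L (V X10 (V X16 L (K U2 U6 [])) (K U0 U4 [V X16 L (K U2 U6 []),V X16 L (V
  X25 L L)])))]),V X9 (V X13 L (V X14 L L)) (V X13 (K U1 U2 [V X14 L (K U2 U7 []),K U0 U4 [],L,K
  U0 U4 []]) (V X18 (V X10 L (K U0 U4 [V X12 L L])) (K U3 U8 [V X26 (V X10 L (V X12 L L)) (K U0 U9 [V
  X10 L (V X19 L (V X20 L (K U1 U5 [V X14 L L]))),V X10 L (V X19 L (V X20 L (K U1 U5 [V X14 L L])))]),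
  V X10 (V X14 L L) (K U0 U4 [K U0 U9 [],V X14 L L]),V X10 (V X14 L L) (K U0 U4 [V X20 L (K U1 U5 [V
  X14 L L]),V X14 L L])]))),V X9 (V X13 L (V X10 L L)) (K U0 U8 [V X13 (K U1 U2 []) (V X10 L (V X20 L
  (V X26 L (K U3 U9 [L,K U1 U5 []])))),V X10 (V X13 (V X14 L L) (K U3 U9 [])) (K U0 U4 [V X13 (K U1
  U2 []) (V X12 L L),V X13 L L]),V X10 (V X13 (V X14 L L) (V X12 L (V X19 L (V X20 L (V X25 L (V X14
  (V X16 L L) (K U2 U7 []))))))) (K U0 U4 [V X13 (K U1 U2 []) (V X12 L L),V X13 L L])])])))),V X1 (V
  X3 (V X2 (V X23 (V X10 L L) (V X21 L (V X19 L L))) (V X21 (V X23 L (K U0 U3 [])) (V X23 L (K U0 U3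
  [L,L,L,V X10 L L,K U1 U2 [],V X19 L L])))) (V X2 (V X23 L (V X21 L (V X12 L (V X19 L L)))) (K U1
  U2 [V X23 L (V X11 (V X13 L L) (V X13 L (V X16 L (V X22 (V X6 L (V X7 L (K U0 U3 []))) (V X6 L (V X7
  L (K U0 U3 []))))))),V X23 L (V X12 L (V X13 L (V X22 L L))),V X21 (V X7 L (V X13 L L)) (V X7 L (K
  U1 U5 [L,K U0 U3 []])),L,L,V X23 (V X19 L L) (K U1 U5 [V X21 L L,V X21 (K U0 U3 []) (K U1 U4
  [L,K U0 U3 []])]),V X23 L (K U1 U5 [L,V X21 L (K U1 U4 [])]),K U0 U3 [L,V X19 L L]]))) (V X3 (V
  X2 (K U0 U3 [V X21 L L,L,V X23 L (V X12 L L),L,V X23 L (V X14 L L),K U1 U2 []]) (K U0 U3 [V X21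
  L (V X20 L L),V X21 L (V X15 L (V X28 L L)),V X14 L (V X13 L (V X12 L L)),V X21 L L,V X14 L (V X13
  L (V X18 L (V X30 L L))),V X13 L (V X21 L (K U0 U8 []))])) (V X2 (V X23 (K U1 U2 [L,L,V X14 L L,
  L,L,K U0 U3 []]) (K U2 U7 [V X20 L (V X7 L (V X27 (V X10 L (V X12 L (V X6 L (V X11 L (K U0 U3
  []))))) (V X10 L (V X12 L (V X6 L (K U1 U7 [])))))),V X12 L (V X20 L L),V X12 L (V X20 L (V X10 L
  L)),V X7 (V X12 L (V X10 L (V X11 L L))) (V X20 L (K U0 U6 [K U0 U3 [L,L,K U1 U2 [],K U1 U2 []],
  V X10 L (V X12 L L)]))])) (V X7 (V X11 L (V X15 (V X12 L L) (V X10 L (V X6 L (V X13 L (V X12 (V X16 L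
  (V X19 L (V X20 L (V X21 L (V X23 L (K U3 U8 [V X17 L L,K U3 U9 [],K U2 U7 []])))))) (V X16 (V X14
  L (K U0 U6 [])) (V X17 (V X14 L (K U2 U5 [])) (V X18 (K U3 U9 []) (K U3 U9 [K U3 U8 [],K U0 U6
  [],K U3 U8 []])))))))))) (K U0 U3 [V X15 L (V X11 (V X12 L L) (V X13 L (V X16 L (V X17 L (V X14 (V
  X18 L (K U3 U8 [])) (V X18 (K U0 U6 []) (V X25 (K U3 U8 []) (K U2 U7 [K U0 U6 [],K U0 U6
  []])))))))),V X13 (V X14 L (V X20 L L)) (V X14 (V X15 L (V X23 L (K U0 U9 [V X12 L (K U1 U4 []),K
  U3 U8 [],V X12 L (K U1 U4 []),K U3 U8 [L,K U1 U4 []]]))) (V X26 (V X12 L (K U1 U4 [])) (K U0 U6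
  [V X10 L (V X21 L (V X23 L (V X29 L (V X12 (V X16 L L) (K U1 U4 [V X16 L L,V X16 L L]))))),K U0 U9
  [V X10 L (V X21 L (V X29 L (V X30 L (V X12 (V X16 L L) (K U1 U4 [V X16 L L,V X16 L L]))))),V X12 L
  (K U1 U4 []),K U3 U8 [L,V X12 L L]],K U0 U9 [V X12 L (K U1 U4 []),V X12 L (V X20 L L),K U3 U8
  []]]))),V X13 (V X10 L (K U1 U5 [])) (V X14 (V X16 L (V X17 L (K U0 U8 []))) (V X16 (V X17 L (K U0
  U8 [L,V X10 L L])) (V X17 (V X18 L (V X20 L (V X21 L (V X24 L (K U6 U9 []))))) (V X29 (V X18 L (K U3
  U6 [])) (K U0 U8 [K U3 U9 [L,V X18 L L],K U3 U9 [L,V X18 L L]]))))),V X14 (V X13 (V X10 L (K U1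
  U5 [])) (V X18 L (K U0 U9 [L,V X16 L (V X20 L (V X24 L (V X25 L (V X30 L (V X10 (V X12 L L) (K U1 U5
  [])))))),K U3 U8 []]))) (V X13 (K U1 U2 [L,V X25 L L,V X20 L L]) (V X26 (V X18 L (V X21 L (K U3
  U8 [V X10 L L]))) (K U0 U6 [V X18 (V X10 L L) (K U0 U9 [V X10 L L,K U3 U8 []]),K U0 U9 []]))),V
  X13 (K U1 U2 [L,K U1 U5 [],K U1 U5 [],K U1 U5 []]) (K U3 U9 [V X21 (V X10 L (V X12 L L)) (K U0
  U8 [V X14 L (V X20 L (V X23 L (K U2 U7 [L,K U1 U4 []]))),V X14 L (V X20 L (V X23 L (K U2 U7 [L,K
  U1 U4 []])))]),V X14 (V X10 L L) (K U0 U6 [V X20 L (V X21 L (V X23 L (K U2 U7 [L,K U1 U4 []]))),V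
  X10 L L]),K U0 U8 [K U0 U6 [],K U0 U6 []]])])))),K U0 U3 [V X3 (V X1 L (V X21 L (V X2 (V X10 L L)
  (V X18 L (K U3 U8 [L,V X20 L (V X10 L L)]))))) (V X1 (V X2 L (V X21 L (V X10 L (V X11 L (V X19 L
  L))))) (V X2 (V X18 L (V X11 L (V X10 L L))) (V X11 (V X18 L (V X20 L L)) (V X7 L (V X18 (V X15 L (V
  X21 L (K U0 U6 [V X10 L (K U1 U5 []),V X10 L (K U1 U5 []),V X10 L (K U1 U5 []),K U2 U7 []])))
  (V X26 (V X10 L (K U1 U5 [])) (K U0 U9 [V X12 L (V X21 L (V X23 L (V X25 L (V X10 (V X17 L L) (K U1
  U5 [V X17 L L]))))),K U0 U6 [V X10 L (K U1 U5 []),K U2 U7 [],V X10 L (V X20 L L)],K U0 U6 [V X12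
  L (V X23 L (V X24 L (V X25 L (V X10 (K U3 U8 []) (K U1 U5 [K U3 U8 []]))))),V X10 L (K U1 U5 []),
  V X10 L (K U1 U5 [])]]))))))),V X3 (V X21 (V X2 L (V X1 L L)) (V X26 (V X1 L (V X2 L (V X28 L (V X10
  L L)))) (V X1 L (V X2 (V X10 L L) (K U3 U8 [L,L,V X10 L (V X30 L L)]))))) (V X2 (V X1 (V X10 L L) (V
  X26 L L)) (V X1 (V X21 L (V X19 L L)) (V X15 (V X11 L (V X12 L (V X18 L (V X21 L (V X23 L (V X25 L (V
  X26 L (V X17 (V X10 L L) (K U3 U9 [V X10 L L]))))))))) (V X11 (V X18 L (K U3 U8 [L,V X20 L L])) (V
  X12 (V X10 L (V X14 L (K U0 U6 []))) (V X10 (V X14 L (K U0 U6 [V X17 L L])) (V X14 (V X16 L (V X20 L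
  (K U5 U7 []))) (V X25 (V X16 L (K U2 U5 [])) (K U0 U6 [K U2 U7 [L,V X16 L L],K U2 U7 [L,V X16 L
  L]]))))))))),V X2 (V X3 L (V X26 L (V X29 L (V X20 L (V X14 L (V X18 L (V X24 L L))))))) (V X3 (V X26
  L (V X25 L (V X20 L (V X14 L (V X30 L (V X18 L L)))))) (V X15 (V X20 (V X25 L (V X29 L (K U6 U9 [])))
  (V X25 (V X29 L (V X1 L (K U4 U8 []))) (V X29 (V X1 L (K U5 U7 [])) (V X1 L (V X21 (V X10 L (K U4 U8
  [])) (V X23 (V X10 L (K U4 U8 [])) (V X26 (V X10 L (K U4 U8 [])) (V X10 (K U5 U7 []) (K U4 U8 [V
  X12 L (V X14 L (V X16 L (K U5 U7 [K U6 U9 [],K U6 U9 []]))),K U5 U7 [],V X12 L (V X14 L (V X16 L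
  (K U5 U7 [K U6 U9 [],K U6 U9 []])))]))))))))) (V X20 (V X1 L (V X16 (V X18 L (K U3 U8 [])) (V X17
  (V X14 L (K U2 U7 [])) (V X25 (V X14 L (V X21 L (V X29 (V X10 L (V X12 L (V X23 L L))) (K U3 U8 [V
  X10 L (V X12 L (V X23 L (V X19 L (V X28 L L)))),K U0 U9 [L,V X10 L (V X12 L (V X23 L L))]])))) (V
  X29 (V X12 L (V X18 L (V X23 L (K U2 U7 [V X10 L (V X21 L (V X19 L (V X22 L (V X27 L L)))),V X10 L (V
  X21 L L)])))) (V X21 (K U2 U7 []) (K U3 U8 [V X23 L (K U2 U7 [V X10 L (V X12 L (V X19 L (V X28 L (V
  X22 L (V X27 L L))))),K U0 U6 [V X10 L (V X12 L (V X19 L (V X28 L L)))]]),V X10 L (V X12 L (V X23 L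
  (K U2 U7 [K U0 U9 [L,V X19 L (V X22 L (V X27 L L))]])))]))))))) (V X1 L (V X16 (V X17 L (V X21 L (V
  X29 (K U3 U4 []) (K U3 U8 [K U4 U8 [],K U3 U4 []])))) (V X17 (V X23 L (V X25 (K U2 U5 []) (K U2
  U7 [K U5 U7 [],K U2 U5 []]))) (V X21 (V X23 L (V X25 (K U2 U5 [L,L,V X10 L L]) (K U2 U7 [V X12 L
  (K U5 U7 [V X10 L L,V X10 L L]),K U2 U5 []]))) (K U3 U4 [V X23 (V X10 L (V X26 L (V X29 L (K U4 U8
  [V X12 L L,V X12 L L])))) (K U2 U5 [V X25 (V X10 L (V X12 L L)) (K U5 U7 [K U4 U8 [],V X10 L (K U4
  U8 []),V X10 L (K U4 U8 [])]),K U2 U7 [K U4 U8 [],K U0 U6 [V X10 L (K U4 U8 [])]],K U2 U7 [V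
  X10 L (K U4 U8 []),V X10 L (K U4 U8 [])]]),K U3 U8 [V X23 L (V X25 (K U2 U5 []) (K U2 U7 [K U5 U7
  [],K U2 U5 []])),V X23 L (V X25 (K U2 U5 []) (K U2 U7 [K U5 U7 [],K U2 U5 []]))],K U3 U8 [V
  X23 L (V X12 (K U2 U7 []) (K U2 U5 [K U5 U7 [],K U2 U7 []])),V X12 (V X14 L (K U2 U7 [])) (V X23
  L (K U2 U5 [K U5 U7 [],K U2 U7 []]))]])))))))),V X1 (V X3 L (V X21 L (K U0 U4 [L,L,V X25 L (K U1
  U5 [])]))) (V X3 (V X21 L (K U0 U8 [L,L,V X25 L (K U3 U9 [])])) (V X25 (V X2 L (V X12 (V X17 L (K
  U3 U9 [])) (V X18 (V X10 L (K U1 U5 [])) (V X20 (V X10 L (V X26 L (V X29 (V X14 L (V X16 L (V X23 L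
  L))) (K U3 U9 [V X14 L (V X16 L (V X23 L (V X19 L (V X21 L (V X22 L (V X24 L (V X30 L L))))))),K U0
  U8 [L,V X14 L (V X16 L (V X23 L L))]])))) (V X29 (V X16 L (V X17 L (V X23 L (K U1 U5 [V X14 L (V X26
  L (V X19 L (V X21 L (V X22 L (V X27 L L))))),V X14 L (V X26 L L)])))) (V X23 (K U3 U9 []) (K U1 U5
  [V X19 L (V X26 L (K U3 U9 [V X14 L (V X16 L (V X21 L (V X22 L (V X27 L (V X24 L (V X30 L L)))))),K
  U0 U8 [L,V X14 L (V X16 L (V X22 L (V X27 L L)))]])),V X14 L (V X16 L (V X26 L (K U3 U9 [K U0 U4 [V
  X21 L (V X24 L (V X30 L L))]])))]))))))) (V X2 L (V X12 (V X18 L (V X26 L (V X29 (K U3 U6 []) (K U3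
  U9 [K U6 U9 [],K U3 U6 []])))) (V X18 (V X23 L (V X20 (K U1 U7 []) (K U1 U5 [K U5 U7 [],K U1 U7
  []]))) (V X23 (V X26 L (V X29 (K U3 U6 [L,L,V X10 L L]) (K U3 U9 [V X14 L (K U6 U9 [V X10 L L,V
  X10 L L]),K U3 U6 []]))) (K U1 U7 [V X26 (V X16 L (V X19 L (V X20 L (K U5 U7 [V X14 L L,V X14 L
  L])))) (K U3 U6 [V X20 (V X14 L (V X16 L L)) (K U5 U7 [V X14 L (V X16 L (K U6 U9 [])),K U6 U9 [],V
  X14 L (K U6 U9 [])]),K U3 U9 [K U5 U7 [],K U0 U8 [L,V X16 L (K U5 U7 [])]],K U3 U9 [V X16 L (K
  U5 U7 []),V X16 L (K U5 U7 [])]]),K U1 U5 [V X26 L (V X29 (K U3 U6 []) (K U3 U9 [K U6 U9 [],K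
  U3 U6 []])),V X26 L (V X29 (K U3 U6 []) (K U3 U9 [K U6 U9 [],K U3 U6 []]))],K U1 U5 [V X14 (V
  X17 L (K U3 U9 [])) (V X26 L (K U3 U6 [K U6 U9 [],K U3 U9 []])),V X26 L (V X14 (K U3 U9 []) (K
  U3 U6 [K U6 U9 [],K U3 U9 []]))]]))))))),V X2 (V X3 (V X26 L (V X1 L L)) (V X1 (V X19 L L) (V X26
  (V X10 L (K U1 U2 [])) (K U0 U6 [L,V X20 L (V X12 L (K U1 U2 [K U2 U7 []]))])))) (V X3 (V X1 (V X19
  L L) (V X18 L (V X26 (K U3 U8 []) (K U0 U9 [L,K U3 U8 [L,V X10 L L]])))) (V X1 (K U0 U4 [L,V X25 L
  (V X12 L (K U1 U2 [K U1 U5 []]))]) (K U1 U2 [K U3 U8 [V X29 L (V X16 (V X12 L (V X19 L (V X20 L (V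
  X21 L (V X22 L (V X23 L (V X26 L (V X28 L (V X30 L L))))))))) (V X20 (V X14 L (K U2 U7 [])) (V X23 (V
  X14 L (V X12 L (V X19 L (V X21 L (V X26 L (V X28 L (V X30 L L))))))) (K U2 U5 [V X25 L (K U5 U7 [V X19
  L (V X21 L (V X22 L (V X24 L (V X26 L (V X27 L (V X28 L (V X30 L L))))))),V X19 L (V X21 L (V X24 L
  (V X26 L (V X27 L (V X28 L (V X30 L L)))))),V X19 L (V X21 L (V X24 L (V X26 L (V X28 L (V X30 L
  L)))))]),K U2 U7 [V X19 L (V X21 L (V X22 L (V X24 L (V X26 L (V X27 L (V X28 L (V X30 L L)))))))],K
  U2 U7 [V X19 L (V X21 L (V X26 L (V X28 L (V X30 L L)))),K U0 U6 [V X19 L (V X21 L (V X26 L (V X28 L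
  (V X30 L L))))]]])))),V X16 L (V X23 L (K U2 U7 [V X12 L (K U5 U7 []),K U2 U5 [],K U2 U5 []])),
  V X16 L (V X20 L (V X23 L (K U2 U5 [K U5 U7 [],L,K U2 U7 []]))),V X16 L (V X20 L (V X23 L (K U2
  U5 [K U5 U7 [],L,K U2 U7 []])))],V X16 (V X18 L (K U1 U5 [])) (V X28 (V X14 L (K U2 U7 [])) (K
  U3 U8 [V X30 L (V X14 L (K U1 U5 [])),V X23 L (K U1 U5 [V X14 L L,V X14 L (K U2 U7 [])]),V X14 L
  (K U1 U5 [])])),K U1 U7 [V X28 (V X18 L L) (K U3 U8 [V X30 L L,K U1 U5 []]),V X24 L (V X28 L (K
  U3 U8 [V X30 L L,V X29 L (K U0 U9 [L,V X19 L (V X20 L (K U5 U7 []))])])),K U1 U5 [V X18 L (K U3 U8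
  []),V X18 L (K U3 U8 [])],K U1 U5 [V X21 (V X18 L L) (K U3 U8 [V X24 L (V X26 L (V X28 L (V X30 L
  L)))]),V X24 L (V X28 L (V X29 L (K U3 U8 [V X30 L L])))]],V X28 (K U1 U5 []) (K U3 U8 [V X30 L (K
  U1 U5 []),K U1 U5 [L,V X29 L L],K U1 U5 []])]))),V X1 (V X3 (V X21 L (V X2 L L)) (V X2 (V X19 L
  L) (V X21 (V X14 L (K U1 U2 [])) (K U0 U4 [L,V X25 L (V X12 L (K U1 U2 [K U1 U5 []]))])))) (V X3 (V
  X2 (V X21 L L) (V X21 (K U3 U9 []) (K U0 U8 [V X20 L (K U3 U9 [])]))) (V X2 (K U0 U6 [L,V X20 L (V
  X12 L (K U1 U2 [K U2 U7 []]))]) (K U3 U9 [K U1 U2 [K U2 U7 [V X12 L (V X16 L (K U5 U7 [])),V X12 L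
  (V X16 L (V X19 L (V X20 L (V X21 L (K U0 U8 [V X24 L (V X25 L (K U5 U7 [V X27 L (V X29 L (V X30 L
  L))]))]))))),V X12 L (V X16 L (K U2 U5 [])),K U2 U5 [L,L,L,V X19 L (V X21 L (K U0 U8 [V X24 L (V
  X29 L (V X30 L L))]))]],V X25 L (K U2 U7 [L,L,K U1 U5 []]),K U1 U5 [K U1 U7 [],V X16 L (K U1 U7
  [])],V X23 L (K U2 U7 [L,K U1 U5 []])],K U1 U2 [V X16 L (V X20 L (V X23 L (K U2 U5 [K U5 U7 [],
  L,K U2 U7 []]))),V X14 L (K U1 U5 []),K U1 U7 [L,L,L,K U1 U5 []],K U1 U5 []],K U1 U2 [V
  X16 L (V X20 L (V X23 L (K U2 U5 [K U5 U7 [],L,K U2 U7 []]))),V X14 L (K U1 U5 []),K U1 U7 [L,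
  L,L,K U1 U5 []],K U1 U5 []]])))],K U0 U1 [V X3 (V X1 (V X21 (V X2 L L) (V X23 L (V X2 L L))) (V
  X2 (V X21 L (V X23 L L)) (V X21 (V X12 L (V X30 (V X7 L (V X10 L (K U1 U3 []))) L)) (K U3 U8 [L,V
  X10 L L,V X11 L (V X7 L (V X16 L (V X17 L (K U1 U3 [V X30 L L,V X30 L L]))))])))) (V X1 (V X23 (K U1
  U3 [L,L,V X2 L (V X19 L L),L,V X2 L (V X19 L L)]) (K U1 U3 [V X2 L (V X22 L L),V X2 L (V X21 L (V
  X7 L (V X19 L L))),V X21 L (V X2 L (K U1 U4 [V X22 L L])),V X2 L L,V X21 L (V X2 L (K U1 U4 [V X22
  L L]))])) (V X2 (V X23 (V X11 L (V X10 L (V X17 L L))) (V X11 L (V X10 L (V X15 L (V X16 L (V X12 L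
  L)))))) (V X7 (V X11 L (V X12 L L)) (V X11 (K U1 U4 [L,K U1 U3 [V X29 L L],L,K U1 U3 []]) (V X15
  (V X18 L (V X23 L (V X17 (V X10 L L) (K U0 U7 [])))) (V X16 (V X18 L (K U0 U9 [L,L,K U3 U8 []]))
  (K U2 U6 [V X18 (V X10 L L) (V X23 (V X17 L L) (K U0 U7 [K U0 U9 [],K U0 U9 []])),V X18 (V X10 L
  L) (V X29 (V X10 L L) (K U0 U9 [K U3 U8 [L,V X10 L L],K U3 U8 [L,V X10 L L]])),K U0 U7 [V X10 (V
  X12 L L) L,V X18 L (V X20 L (V X21 L (K U3 U8 [K U1 U4 []])))]]))))))),V X3 (V X1 (V X21 L (V X2 L
  L)) (K U1 U3 [V X2 L (V X15 L L),V X2 (V X21 L L) (V X21 L (V X15 L (K U3 U8 [L,V X30 L L]))),V X2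
  L (V X21 L L),V X2 L L,V X2 L (V X21 L L)])) (V X1 (V X2 (V X21 L (V X19 L L)) (V X21 (V X12 L (V
  X22 (V X15 L (V X18 L L)) L)) (K U1 U4 [V X19 L L,V X29 L (V X22 (V X17 L (V X18 L L)) L)]))) (V X2
  (V X12 (V X11 L L) (V X11 L (V X17 L (V X15 L (K U1 U3 []))))) (V X15 (V X11 L (V X23 L (V X12 (K U0
  U7 []) (K U0 U5 [K U0 U7 [],V X17 L (K U0 U7 [])])))) (V X12 (V X11 (V X18 L (K U3 U8 [])) (V X16
  L (K U0 U7 [L,V X10 L (V X20 L (V X22 L (V X27 L (V X29 L (V X17 (V X18 L L) (K U3 U9 [])))))),K U2
  U6 []]))) (V X11 (K U1 U3 [K U1 U4 [],V X20 L L]) (V X23 (V X16 L (V X20 L (V X25 L (K U2 U6 [K U1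
  U4 []])))) (K U0 U5 [K U0 U7 [],V X16 (K U1 U4 []) (K U0 U7 [K U1 U4 [],K U1 U4 []])]))))))),K
  U0 U3 [V X2 (V X23 (V X1 L (V X3 L L)) (V X3 L (V X1 L (V X27 L L)))) (V X1 (V X3 L (V X23 (V X29 L L)
  (K U0 U5 [L,L,V X29 L L]))) (V X3 (V X30 L L) (V X15 L (V X17 (V X16 L (K U2 U6 [])) (V X24 (V X16
  L (V X18 L (K U3 U8 []))) (K U2 U6 [V X27 L (V X18 L (K U3 U8 [])),V X18 L (K U3 U8 []),V X29 L
  (K U3 U8 [])])))))),V X1 (V X23 (V X2 L (V X3 L L)) (V X3 L (V X2 L (V X12 L L)))) (V X2 (V X3 L (V
  X23 (V X17 L L) (V X29 L (V X27 L L)))) (V X3 (V X28 L L) (V X18 (V X12 L (K U1 U4 [])) (V X19 (V X12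
  L (V X17 L (K U3 U9 []))) (K U1 U4 [V X22 L (V X17 L (K U3 U9 [])),V X17 L (K U3 U9 []),V X29 L
  (K U3 U9 [])]))))),V X1 (V X2 (V X23 L (V X3 L L)) (V X3 (V X22 L L) (V X12 L (V X23 (K U1 U4 [])
  (K U0 U5 [L,K U1 U4 []]))))) (V X2 (V X3 (V X18 L L) (V X16 L (V X23 (K U2 U6 []) (K U0 U7 [L,K U2
  U6 []])))) (V X3 (V X18 L (K U0 U9 [L,L,K U3 U8 []])) (K U1 U4 [V X20 L (K U3 U8 [V X29 L (V X24
  (V X16 L (V X19 L (V X22 L L))) (K U2 U6 [V X27 L (V X19 L (V X22 L L)),V X19 L (V X22 L L)])),V X19
  L (V X22 L L),V X19 L (V X22 L (V X16 L L)),V X19 L (V X22 L (V X16 L L))]),V X24 (V X16 L (V X18 L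
  L)) (K U2 U6 [V X27 L (V X18 L L),V X18 L L,V X18 L (K U3 U8 [])]),V X24 (V X16 L (V X18 L L)) (K
  U2 U6 [V X27 L (V X18 L L),V X18 L L,V X18 L (K U3 U8 [])]),V X24 L (K U2 U6 [V X27 L L,L,V X18
  L (V X28 L (V X29 L L))])]))),V X1 (V X2 (V X23 L (V X3 L L)) (V X3 L (V X12 L (V X23 (K U1 U4 [])
  (K U0 U5 [L,K U1 U4 []]))))) (V X2 (V X3 (V X23 L L) (V X16 L (V X23 (K U2 U6 []) (K U0 U7 [L,K U2
  U6 []])))) (V X3 (K U0 U8 [L,K U3 U9 []]) (K U3 U9 [V X19 (V X12 L L) (K U1 U4 [V X22 L L,L,V X16
  L (V X24 L (V X25 L (V X28 L (V X29 L (V X30 L L)))))]),K U2 U6 [V X19 L (K U1 U4 [V X22 L L]),V X12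
  L L,V X12 L L],K U2 U6 [V X19 L (V X20 L (K U1 U4 [V X22 L L])),V X12 L L,V X12 L L]])))],V X1 (V
  X2 (V X23 L (V X3 L (V X12 L L))) (V X3 (V X22 L L) (V X23 (K U1 U3 []) (K U0 U5 [V X15 L L,L,K U1
  U4 [K U1 U3 []]])))) (V X2 (V X3 (V X23 L L) (V X23 (K U1 U3 []) (K U0 U7 [V X12 L L,V X12 L L,V
  X15 L (K U2 U6 [V X12 L L])]))) (V X3 (V X18 L (K U0 U9 [L,L,L,K U3 U8 [L,K U1 U3 []]])) (K U1 U3
  [V X15 (V X29 L (K U4 U8 [])) (V X17 (V X20 L (V X22 L (V X24 L (V X25 L (K U2 U6 [V X27 L L,K U0 U7
  [L,V X18 L (K U3 U8 [])]]))))) (K U3 U4 [K U2 U6 [V X20 L (K U4 U8 [V X21 L (V X22 L (V X23 L (V X24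
  L (V X27 L L)))),V X21 L (V X22 L (V X23 L (V X24 L (V X27 L L))))]),K U4 U8 [],K U4 U8 [],K U0
  U7 [L,V X19 L (K U4 U8 [])]],V X21 (V X22 L (V X24 L (V X25 L (K U2 U6 [V X27 L L])))) (K U3 U8 [V
  X22 L (V X24 L (V X25 L (K U2 U6 [V X27 L L,V X29 L L]))),V X20 (V X16 L L) (V X22 (V X16 L L) (V
  X24 (V X16 L L) (K U2 U6 [V X27 L L])))]),V X24 L (K U2 U6 [V X27 L L,L,K U3 U8 []]),V X22 L (V
  X24 L (K U2 U6 [V X27 L L,L,K U4 U8 []]))])),V X29 (K U1 U4 []) (K U1 U8 [V X20 L L,L,K U1 U4
  []]),V X24 (K U1 U4 []) (K U2 U6 [V X27 L (K U1 U4 []),K U1 U4 [],V X18 L (V X21 L (K U3 U8 [K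
  U1 U4 []]))]),K U1 U8 [K U2 U6 [V X23 L (V X24 L (V X27 L L))],K U1 U4 [K U2 U6 [V X23 L (V X24 L
  (V X27 L L))],V X26 L (K U2 U6 [V X23 L (V X24 L (V X27 L L))])],K U1 U4 [V X16 L (K U2 U6 []),V
  X16 L (K U2 U6 [])]]]))),K U0 U3 [V X3 (V X21 (V X1 L (V X2 L L)) (V X1 L (V X2 L (V X28 L L)))) (V
  X1 (V X2 (V X17 L L) (V X19 L L)) (V X2 (V X29 L (V X27 L L)) (K U1 U5 [V X17 L (K U3 U9 []),V X17 L
  (K U3 U9 []),V X16 L (V X18 L (V X25 L (K U2 U6 [V X17 L (K U3 U9 [])])))]))),V X1 (V X2 (V X3 L
  L) (V X3 L (K U0 U4 [K U1 U5 []]))) (V X2 (V X3 L (V X16 L (K U0 U7 [L,L,K U2 U6 []]))) (V X3 (V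
  X18 L (K U0 U9 [L,L,K U3 U8 []])) (K U1 U5 [V X21 (V X16 L (V X18 L L)) (K U3 U8 [V X22 L (V X24 L
  (K U2 U6 [V X27 L L])),V X16 L L,V X16 L L]),V X24 (V X16 L (V X18 L L)) (K U2 U6 [V X27 L (V X18 L
  L),V X18 L L,V X18 L (K U3 U8 [])]),V X16 (K U3 U8 []) (K U2 U6 [V X18 L (K U3 U8 []),L,V X18
  L (K U3 U8 [V X19 L (V X27 L (V X28 L (V X29 L L)))])])]))),V X1 (V X3 (V X2 L (V X19 L L)) (V X2 (V
  X16 L L) (V X21 (K U1 U5 []) (K U0 U4 [K U1 U5 []])))) (V X3 (V X2 (V X21 L L) (V X21 (K U3 U9 [])
  (K U0 U8 [K U3 U9 []]))) (V X2 (V X16 L (K U0 U7 [L,L,K U2 U6 []])) (K U3 U9 [K U1 U5 [L,L,V X16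
  L (V X24 L (V X25 L (V X27 L (V X29 L (V X30 L L)))))],K U2 U6 [K U1 U5 []],K U2 U6 [K U1 U5
  []]])))]],K U0 U1 [V X1 (V X21 (V X2 L (V X3 L L)) (V X23 (V X2 L (V X3 L (V X19 L L))) (V X3 L (V
  X2 (V X12 L L) (K U1 U4 [L,V X11 L (V X22 L L)]))))) (V X2 (V X3 L (V X23 L (V X7 L L))) (V X3 (V X21
  L (V X28 L L)) (V X7 (V X11 L L) (V X11 (V X12 L (K U1 U4 [V X20 L L])) (V X18 (V X16 L (K U2 U6 []))
  (V X17 (V X16 L (K U0 U7 [L,L,K U2 U6 []])) (V X16 (V X20 L (V X23 L (V X24 L (K U6 U9 [])))) (V
  X25 (K U2 U9 []) (K U0 U7 [K U2 U6 [],K U2 U6 []]))))))))),V X1 (V X3 L (V X21 L (V X2 (V X10 L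
  L) (K U1 U4 [L,V X22 (V X11 L L) L])))) (V X3 (V X2 L (V X21 L (V X10 L (V X28 L (V X11 L L))))) (V
  X2 (V X12 L (V X11 L (V X10 L L))) (V X11 (V X12 L (V X29 L L)) (K U0 U7 [V X18 L (V X23 (V X17 L L)
  (V X27 (V X17 L L) (V X17 (V X10 L (K U0 U5 [])) (V X26 (K U0 U5 []) (K U3 U9 [V X10 L (K U0 U5
  []),K U0 U5 []]))))),V X17 L (K U3 U9 []),V X18 L (V X12 (V X17 L (K U3 U9 [])) (K U0 U5 [V X17
  L (V X29 L L),V X17 L (K U3 U9 [])])),K U2 U6 [V X18 L (V X12 (V X17 L (K U3 U9 [])) (K U0 U5 [L,
  K U1 U4 []])),V X12 L L]])))),V X2 (V X1 (V X23 L (V X3 L (V X11 L L))) (V X3 (V X23 L L) (V X23 (K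
  U2 U3 []) (K U0 U7 [V X11 L L,L,K U2 U6 [K U2 U3 []]])))) (V X1 (V X3 (V X22 L L) (V X23 (K U2 U3
  []) (K U0 U5 [V X11 L L,V X11 L L,V X11 L (K U1 U4 [V X16 L L])]))) (V X3 (V X17 L (K U0 U8 [L,L,
  V X25 L (K U2 U3 [K U3 U9 []])])) (K U2 U3 [V X11 (V X29 L (K U6 U9 [])) (V X18 (V X19 L (V X20 L (K
  U1 U4 [V X22 L L,K U0 U5 [V X17 L (K U3 U9 [])]]))) (K U3 U6 [K U1 U4 [V X20 L (V X25 L (K U6 U9 [V
  X19 L (V X22 L L),L,V X19 L (V X22 L L)])),K U6 U9 [],K U6 U9 [],K U0 U5 [V X23 L (V X24 L (K
  U6 U9 []))]],V X26 (V X19 L (V X20 L (K U1 U4 [V X22 L L]))) (K U3 U9 [V X19 (V X12 L L) (K U1 U4 [V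
  X22 L L]),V X19 L (V X20 L (K U1 U4 [V X22 L L]))]),V X19 L (K U1 U4 [V X22 L L,L,K U3 U9 []]),V
  X19 L (K U1 U4 [V X22 L L,L,K U6 U9 []])])),V X29 (K U2 U6 []) (K U2 U9 [V X25 L L,L,K U2 U6
  []]),K U2 U9 [V X19 (V X12 L L) (K U1 U4 [V X22 L L]),K U1 U4 [V X19 L (V X22 L L)],K U2 U6 [V X12
  L (K U1 U4 []),V X12 L (K U1 U4 [])],K U2 U6 [K U1 U4 [V X19 L (V X22 L L)],V X21 L (K U1 U4 [V
  X19 L (V X22 L L)])]],V X19 (K U2 U6 []) (K U1 U4 [V X22 L (K U2 U6 []),K U2 U6 [],V X26 L (K U3
  U9 [L,K U2 U6 []])])]))),V X1 (V X2 L (V X23 L (K U0 U5 [L,L,L,K U1 U4 [V X29 L L]]))) (V X2 (V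
  X23 L (K U0 U7 [L,L,L,K U2 U6 [V X29 L L]])) (V X29 (V X3 L (V X20 (V X12 L (V X26 L (V X25 (V X16
  L (V X17 L (V X18 L (V X21 L L)))) (K U2 U6 [V X17 L (V X18 L (V X21 L (V X19 L (V X22 L (V X23 L (V
  X24 L (V X30 L L))))))),K U0 U7 [L,V X17 L (V X18 L (V X21 L L))]])))) (V X25 (V X16 L (V X17 L (V
  X21 L (K U1 U4 [V X18 L (V X26 L (V X19 L (V X28 L L))),V X18 L (V X26 L L)])))) (V X21 (K U2 U6 [])
  (K U1 U4 [V X22 L (V X26 L (K U2 U6 [V X17 L (V X18 L (V X19 L (V X28 L (V X23 L (V X24 L (V X30 L
  L)))))),K U0 U7 [L,V X17 L (V X18 L (V X19 L (V X28 L L)))]])),V X17 L (V X18 L (V X26 L (K U2 U6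
  [K U0 U5 [V X23 L (V X24 L (V X30 L L))]])))]))))) (V X3 L (V X21 (V X26 L (V X25 (K U2 U9 [L,L,V
  X12 L L]) (K U2 U6 [V X18 L (K U6 U9 [V X12 L L,V X12 L L]),K U2 U9 []]))) (K U1 U8 [V X26 (V X17 L
  (V X20 L (K U4 U8 [V X16 L L,V X16 L L]))) (K U2 U9 [V X20 (V X17 L (V X18 L L)) (K U4 U8 [V X17 L (V
  X18 L (K U6 U9 [])),K U6 U9 [],V X18 L (K U6 U9 [])]),K U2 U6 [K U4 U8 [],K U4 U8 []],K U2
  U6 [V X17 L (K U4 U8 []),V X17 L (K U4 U8 [])]]),K U1 U4 [V X26 L (V X25 (K U2 U9 []) (K U2 U6 [K
  U6 U9 [],K U2 U9 []])),V X26 L (V X25 (K U2 U9 []) (K U2 U6 [K U6 U9 [],K U2 U9 []]))],K U1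
  U4 [V X26 L (V X18 (K U2 U6 []) (K U2 U9 [K U6 U9 [],K U2 U6 []])),V X18 (V X16 L (K U2 U6 []))
  (V X26 L (K U2 U9 [K U6 U9 [],K U2 U6 []]))]]))))),V X3 (V X1 (V X21 L (V X2 L L)) (V X2 (V X21 L
  L) (V X21 (V X16 L (K U2 U3 [])) (K U0 U8 [L,V X25 L (K U2 U3 [K U3 U9 []])])))) (V X1 (V X2 (V X19
  L L) (V X21 (K U2 U3 []) (K U0 U4 [V X25 L (K U1 U5 [])]))) (V X2 (K U0 U7 [L,L,L,K U2 U3 [K U2
  U6 []]]) (K U1 U5 [K U2 U3 [V X18 L (V X25 L (K U3 U6 [K U6 U9 [],V X26 L (K U3 U9 [])])),K U2 U9
  [L,L,L,K U2 U6 []],K U2 U6 []],K U2 U3 [V X18 L (V X25 L (K U3 U6 [K U6 U9 [],V X26 L (K U3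
  U9 [])])),K U2 U9 [L,L,L,K U2 U6 []],K U2 U6 []],K U2 U3 [V X18 L (V X26 L (V X17 (K U0 U4 [V
  X21 L (V X24 L (K U6 U9 []))]) (K U3 U6 [K U3 U9 []]))),K U2 U6 [V X25 L (V X18 L (K U2 U9 [])),K
  U2 U9 [],K U6 U9 []],V X25 L (K U2 U6 [])]])))],K U0 U3 [V X1 (V X3 (V X21 L (V X2 L L)) (K U1
  U3 [V X2 L (V X22 L L),V X2 L (V X21 L (V X19 L L)),V X2 L L,V X21 L (V X2 L (K U1 U4 [V X22 L
  L]))])) (V X3 (V X2 (V X21 L L) (V X21 (K U1 U3 []) (K U3 U8 [V X28 L L,V X7 L (K U1 U3 [])]))) (V
  X2 (V X18 L (V X24 L L)) (V X7 (V X11 L (V X18 L L)) (K U0 U6 [V X18 (V X11 (V X12 L L) (K U2 U7 []))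
  (V X11 (K U1 U3 []) (K U0 U9 [L,L,K U3 U8 []])),V X18 (V X11 (V X12 L L) (V X17 L (V X20 L (V X26
  L (V X29 L (V X30 L (V X10 (V X12 L L) (K U1 U5 [])))))))) (V X11 (K U1 U3 []) (K U0 U9 [L,L,K U3
  U8 []])),V X11 (K U1 U3 []) (K U2 U7 [L,V X10 L L])])))),V X3 (K U1 U3 [V X26 (V X1 L L) (V X1 L
  (V X2 L (V X28 L L))),V X21 (V X2 L L) (V X26 (V X1 L (V X2 L L)) (V X1 L (V X2 L (K U3 U8 [L,V X30
  L L])))),V X1 L (V X2 L (V X26 L (V X30 L L))),V X1 L (V X2 L (V X21 L (K U1 U8 [])))]) (V X1 (V X2
  (K U1 U3 []) (V X21 (K U1 U3 []) (K U1 U4 [V X11 L L,V X11 L (V X10 L (K U1 U3 [V X22 L L,V X22 L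
  L]))]))) (V X2 (V X11 L (V X26 L (K U0 U6 []))) (V X11 (K U1 U3 [K U0 U6 [],K U3 U8 [],K U1 U4
  []]) (K U2 U7 [V X26 (V X10 (V X12 L L) L) (K U0 U6 [V X12 L (V X20 L (K U1 U4 [V X17 L L])),V X12 L
  (V X20 L (K U1 U4 [V X17 L L]))]),V X12 (V X17 L L) (K U0 U5 [V X17 L L,K U1 U4 [V X17 L L]]),K U0
  U6 [K U0 U5 [],K U0 U5 []]])))),V X3 (V X2 (V X26 L (V X1 L L)) (V X1 (V X22 L L) (V X26 (V X12 L
  (K U1 U3 [])) (K U0 U9 [L,L,K U3 U8 [L,V X12 L (K U1 U3 [])]])))) (V X2 (V X1 (V X22 L L) (V X26
  (K U2 U7 []) (K U0 U6 [V X20 L (K U2 U7 [])]))) (V X1 (K U0 U5 [L,L,K U1 U4 [V X18 L (K U1 U3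
  [])]]) (K U2 U7 [K U1 U3 [V X17 L (V X21 L (V X18 (K U1 U4 []) (K U3 U8 [K U1 U4 [],K U1 U4
  []]))),V X17 L (V X21 L (V X18 (K U4 U8 []) (K U3 U4 [K U3 U8 []]))),K U1 U4 [V X20 L (V X18 L (K
  U3 U8 []))],K U1 U4 [K U1 U8 [L,V X20 L (V X22 L (V X25 L (V X27 L L)))],V X21 L (K U1 U8 []),K
  U4 U8 [V X22 L (V X25 L (V X27 L L))]]],K U1 U3 [V X18 L (K U3 U8 []),V X17 L (V X20 L (K U3 U4 [K
  U4 U8 [],V X21 L (K U3 U8 [])])),K U1 U4 [],K U1 U8 [L,K U1 U4 []]],K U1 U3 [V X18 L (K U3 U8
  []),V X17 L (V X20 L (K U3 U4 [K U4 U8 [],V X21 L (K U3 U8 [])])),K U1 U4 [],K U1 U8 [L,K U1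
  U4 []]]]))),K U0 U1 [V X2 (V X3 (V X26 L (V X1 L L)) (V X1 (V X12 L L) (V X26 (K U2 U7 []) (K U0 U6
  [K U2 U7 []])))) (V X3 (V X1 (V X22 L L) (V X18 L (V X26 (K U3 U8 []) (K U0 U9 [L,K U3 U8 []]))))
  (V X1 (V X12 L (K U0 U5 [L,K U1 U4 []])) (K U2 U7 [K U1 U4 [V X19 L (V X22 L (V X18 L L)),K U3 U8
  [],V X18 L L,V X18 L (V X22 L (V X25 L (V X27 L (V X28 L (V X29 L L)))))],V X21 (V X12 L L) (K U1
  U4 [K U3 U8 [V X19 L (V X22 L L)],V X18 L L,V X18 L L]),V X21 (V X12 L L) (K U1 U4 [K U3 U8 [K U0
  U6 [V X19 L (V X22 L L)]],V X18 L L,V X18 L L])]))),V X2 (V X3 (V X26 L (V X1 L L)) (V X1 (V X19 L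
  L) (V X26 (K U2 U7 []) (K U0 U6 [K U2 U7 []])))) (V X3 (V X1 L (V X18 L (V X26 (K U3 U8 []) (K U0
  U9 [L,K U3 U8 []])))) (V X1 (K U0 U4 [K U1 U5 []]) (K U1 U5 [K U2 U7 [V X18 L (K U3 U8 []),V X18
  L L,V X18 L L],K U2 U7 [V X18 L (K U3 U8 []),V X18 L L,V X18 L L],V X28 L (V X29 L (K U3 U8 [V
  X30 L L,V X19 L (V X25 L (V X27 L L))]))])))],K U0 U1 [V X1 (V X2 (V X3 L L) (V X3 L (V X12 L (K U0
  U5 [L,K U1 U4 []])))) (V X2 (V X3 L (K U0 U6 [K U2 U7 []])) (V X3 (K U0 U8 [L,K U3 U9 []]) (K U2
  U7 [K U3 U9 [K U1 U4 [L,L,L,V X22 L (V X24 L (V X25 L (V X27 L (V X28 L (V X29 L (V X30 L L))))))],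
  K U1 U4 [],K U1 U4 []],K U3 U9 [V X12 L L,V X12 L L,V X12 L L],K U3 U9 [K U1 U4 [],V X12 L L,
  V X12 L L]]))),V X1 (V X3 (V X2 L (V X19 L L)) (V X2 (V X19 L L) (V X21 (K U1 U5 []) (K U0 U4 [K U1
  U5 []])))) (V X3 (V X2 L (V X21 (K U3 U9 []) (K U0 U8 [K U3 U9 []]))) (V X2 (K U0 U6 [K U2 U7 []])
  (K U1 U5 [K U2 U7 [K U3 U9 []],K U2 U7 [K U3 U9 []],K U3 U9 [V X24 L (V X25 L (V X27 L (V X29 L (V
  X30 L L))))]])))]]]"

text \<open>The whole finite problem, by evaluation; \<open>blank\<close> means that nothing is
  known except that the vertex in the middle is a codeword.\<close>

lemma check_cert: "check cert blank"
  by code_simp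

subsection \<open>Soundness of the checker\<close>

definition agrees :: "(site \<Rightarrow> bool) \<Rightarrow> marks \<Rightarrow> bool" where
  "agrees Q s \<longleftrightarrow> (\<forall>x. (look x s = Yes \<longrightarrow> Q x) \<and> (look x s = No \<longrightarrow> \<not> Q x))"

lemma agreesD:
  assumes "agrees Q s"
  shows "look x s = Yes \<Longrightarrow> Q x" and "look x s = No \<Longrightarrow> \<not> Q x"
  using assms by (auto simp: agrees_def)

lemma agrees_blank: "agrees Q blank"
proof -
  have "look x blank = Unknown" for x
    by (cases x) (simp_all add: blank_def Let_def)
  then show ?thesis
    by (simp add: agrees_def)
qed

lemma look_upd: "look y (upd x a s) = (if y = x then a else look y s)"
  \<comment> \<open>The case rule of \<open>rot_marks\<close> exposes all thirty entries of
    \<open>s\<close> at once.\<close>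
  by (cases s rule: rot_marks.cases; cases x; cases y; simp)

lemma agrees_upd_Yes: "agrees Q s \<Longrightarrow> Q x \<Longrightarrow> agrees Q (upd x Yes s)"
  by (auto simp: agrees_def look_upd)

lemma agrees_upd_No: "agrees Q s \<Longrightarrow> \<not> Q x \<Longrightarrow> agrees Q (upd x No s)"
  by (auto simp: agrees_def look_upd)

lemma agrees_rot: "agrees Q s \<Longrightarrow> agrees (Q \<circ> rot) (rot_marks s)"
proof -
  have "look x (rot_marks s) = look (rot x) s" for x
    by (cases s rule: rot_marks.cases; cases x; simp)
  then show "agrees Q s \<Longrightarrow> agrees (Q \<circ> rot) (rot_marks s)"
    by (simp add: agrees_def)
qed

lemma agrees_ref: "agrees Q s \<Longrightarrow> agrees (Q \<circ> ref) (ref_marks s)"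
proof -
  have "look x (ref_marks s) = look (ref x) s" for x
    by (cases s rule: rot_marks.cases; cases x; simp)
  then show "agrees Q s \<Longrightarrow> agrees (Q \<circ> ref) (ref_marks s)"
    by (simp add: agrees_def)
qed

text \<open>Listed in the order of \<open>orbit\<close>. Since marks are pulled back, the operation
  applied last to the marks is the innermost function here.\<close>

definition syms :: "(site \<Rightarrow> site) list" where
  "syms = [id, rot, rot \<circ> rot, ref, ref \<circ> rot, ref \<circ> rot \<circ> rot]"

lemma agrees_orbit: "agrees Q s \<Longrightarrow> list_all2 (\<lambda>g s. agrees (Q \<circ> g) s) syms (orbit s)"
  by (simp add: syms_def orbit_def agrees_rot agrees_ref comp_assoc[symmetric])

section \<open>Movements of weight and their bounds under partial knowledge\<close>

fun sends :: "rule \<Rightarrow> (site \<Rightarrow> bool) \<Rightarrow> bool" where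
  "sends (a, p, q, ls) Q \<longleftrightarrow> Q p \<and> (\<forall>l\<in>set ls. Q (fst (snd l)) = fst l)"

fun receives :: "rule \<Rightarrow> (site \<Rightarrow> bool) \<Rightarrow> bool" where
  "receives (a, p, q, ls) Q \<longleftrightarrow> Q q \<and> (\<forall>l\<in>set ls. Q (snd (snd l)) = fst l)"

text \<open>Every symmetry counts separately, even if two of them name the same receiver. Outflow
  and inflow can then be compared for each rule and symmetry on its own.\<close>

definition outflow :: "(site \<Rightarrow> bool) \<Rightarrow> nat" where
  "outflow Q = (\<Sum>g\<leftarrow>syms. \<Sum>r\<leftarrow>rules. fst r * of_bool (sends r (Q \<circ> g)))"

definition inflow :: "(site \<Rightarrow> bool) \<Rightarrow> nat" where
  "inflow Q = (\<Sum>g\<leftarrow>syms. \<Sum>r\<leftarrow>rules. fst r * of_bool (receives r (Q \<circ> g)))"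

lemma certainD: "agrees Q s \<Longrightarrow> certain b (look x s) \<Longrightarrow> Q x = b"
  using agreesD[of Q s x] by (cases "look x s") auto

lemma possibleI: "agrees Q s \<Longrightarrow> Q x = b \<Longrightarrow> possible b (look x s)"
  using agreesD[of Q s x] by (cases "look x s") auto

lemma all_certainD: "agrees Q s \<Longrightarrow> all_certain ls s \<Longrightarrow> \<forall>l\<in>set ls. Q (fst (snd l)) = fst l"
  by (induction ls s rule: all_certain.induct) (auto dest: certainD)

lemma all_possibleI: "agrees Q s \<Longrightarrow> \<forall>l\<in>set ls. Q (snd (snd l)) = fst l \<Longrightarrow> all_possible ls s"
  by (induction ls s rule: all_possible.induct) (auto intro: possibleI)

lemma add_if_eq: "add_if b a n = a * of_bool b + n"
  by (cases b) simp_all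

text \<open>A certain condition holds in every code that agrees with the marks, so the marks can
  only undercount what is sent. Dually, \<open>max_inflow_ge\<close> can only overcount what is
  received.\<close>

lemma sure_outflow_le:
  assumes "agrees Q s"
  shows "sure_outflow rs s \<le> (\<Sum>r\<leftarrow>rs. fst r * of_bool (sends r Q))"
  using assms
proof (induction rs s rule: sure_outflow.induct)
  case (2 a p q ls rs s)
  have "certain True (look p s) \<and> all_certain ls s \<Longrightarrow> sends (a, p, q, ls) Q"
    using certainD[OF "2.prems", of True p] all_certainD[OF "2.prems", of ls] by simp
  then show ?case
    using "2.IH"[OF "2.prems"] by (auto simp: add_if_eq simp del: sends.simps intro!: add_mono)
qed simp

lemma max_inflow_ge:
  assumes "agrees Q s"
  shows "(\<Sum>r\<leftarrow>rs. fst r * of_bool (receives r Q)) \<le> max_inflow rs s"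
  using assms
proof (induction rs s rule: max_inflow.induct)
  case (2 a p q ls rs s)
  have "receives (a, p, q, ls) Q \<Longrightarrow> possible True (look q s) \<and> all_possible ls s"
    using possibleI[OF "2.prems", of q True] all_possibleI[OF "2.prems", of ls] by simp
  then show ?case
    using "2.IH"[OF "2.prems"] by (auto simp: add_if_eq simp del: receives.simps intro!: add_mono)
qed simp

lemma sum_over_sure_outflow_le:
  assumes "list_all2 (\<lambda>g s. agrees (Q \<circ> g) s) gs ss"
  shows "sum_over (sure_outflow rs) ss \<le> (\<Sum>g\<leftarrow>gs. \<Sum>r\<leftarrow>rs. fst r * of_bool (sends r (Q \<circ> g)))"
  using assms
proof (induction rule: list_all2_induct)
  case (Cons g gs s ss)
  from add_mono[OF sure_outflow_le[OF Cons.hyps(1), of rs] Cons.IH] show ?case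
    by (simp add: comp_def)
qed simp

lemma inflow_le_sum_over:
  assumes "list_all2 (\<lambda>g s. agrees (Q \<circ> g) s) gs ss"
  shows "(\<Sum>g\<leftarrow>gs. \<Sum>r\<leftarrow>rs. fst r * of_bool (receives r (Q \<circ> g))) \<le> sum_over (max_inflow rs) ss"
  using assms
proof (induction rule: list_all2_induct)
  case (Cons g gs s ss)
  from add_mono[OF max_inflow_ge[OF Cons.hyps(1), of rs] Cons.IH] show ?case
    by (simp add: comp_def)
qed simp

section \<open>Weight received from the ten vertices around a codeword\<close>

definition separated :: "(site \<Rightarrow> bool) \<Rightarrow> bool" where
  "separated Q \<longleftrightarrow> (\<forall>u v. u \<noteq> v \<longrightarrow> (\<exists>x\<in>set (sep u v). Q x))"

definition hits :: "(site \<Rightarrow> bool) \<Rightarrow> center \<Rightarrow> nat" where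
  "hits Q u = length (filter Q (ball u))"

text \<open>In units of \<open>1/48\<close>: a vertex that sees \<open>n\<close> other codewords
  gives \<open>48 / (n + 1)\<close>, but never less than \<open>48 / 4\<close>.\<close>

definition weight :: "nat \<Rightarrow> nat" where
  "weight n = (if n = 0 then 48 else if n = 1 then 24 else if n = 2 then 16 else 12)"

definition balanced :: "(site \<Rightarrow> bool) \<Rightarrow> bool" where
  "balanced Q \<longleftrightarrow> (\<Sum>u\<leftarrow>centers. weight (hits Q u)) + inflow Q \<le> 228 + outflow Q"

lemma count_yes_le: "agrees Q s \<Longrightarrow> count_yes xs s \<le> length (filter Q xs)"
proof (induction xs)
  case (Cons x xs)
  then show ?case
    using agreesD[OF Cons.prems, of x] by (cases "look x s") auto
qed simp

text \<open>\<open>weight\<close> is antitone, so knowing \<open>m\<close> of the codewords already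
  justifies the drop for \<open>m\<close>; the last summand pays for the exceptional value
  \<open>48\<close>.\<close>

lemma weight_drop: "m \<le> n \<Longrightarrow> weight n + drop_of m \<le> 24 + 24 * of_bool (n = 0)"
  by (cases m rule: drop_of.cases) (auto simp: weight_def)

text \<open>Two centers that both see no codeword besides the middle one could not be told apart. So
  at most one of the ten gives \<open>48\<close>, and the others give at most
  \<open>24\<close>.\<close>

lemma weights_le:
  assumes "agrees Q s" "separated Q"
  shows "(\<Sum>u\<leftarrow>centers. weight (hits Q u)) + drops (counts balls s)
    \<le> 240 + 24 * of_bool (some_zero (counts balls s))"
proof -
  let ?Z = "\<lambda>us. filter (\<lambda>u. hits Q u = 0) us"
  have cy: "count_yes (ball u) s \<le> hits Q u" for u
    unfolding hits_def by (rule count_yes_le[OF assms(1)])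
  have total: "(\<Sum>u\<leftarrow>us. weight (hits Q u)) + drops (counts (map ball us) s)
      \<le> 24 * length us + 24 * length (?Z us)" for us
  proof (induction us)
    case (Cons u us)
    then show ?case
      using weight_drop[OF cy[of u]] by auto
  qed simp
  have "length (?Z centers) \<le> of_bool (some_zero (counts balls s))"
  proof -
    have "u = v" if "hits Q u = 0" "hits Q v = 0" for u v
    proof (rule ccontr)
      assume "u \<noteq> v"
      then obtain x where "x \<in> set (sep u v)" "Q x"
        using assms(2) by (auto simp: separated_def)
      then show False
        using that by (auto simp: sep_def hits_def filter_empty_conv)
    qed
    then have "card (set (?Z centers)) \<le> 1"
      by (auto simp: card_le_Suc0_iff_eq)
    then have one: "length (?Z centers) \<le> 1"
      by (subst distinct_card[symmetric]) (simp_all add: centers_def)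
    \<comment> \<open>Known codewords are a lower bound for \<open>hits\<close>, so a true zero also
      shows up in the counts.\<close>
    have zero: "some_zero (counts (map ball us) s)" if "u \<in> set us" "hits Q u = 0" for u us
      using that by (induction us) (use cy[of u] in auto)
    have "some_zero (counts balls s)" if "?Z centers \<noteq> []"
    proof -
      from that obtain u where "u \<in> set centers" "hits Q u = 0"
        by (auto simp: filter_empty_conv)
      from zero[OF this] show ?thesis
        by (simp add: balls_def)
    qed
    with one show ?thesis
      by (cases "?Z centers = []") auto
  qed
  moreover have "length centers = 10"
    by (simp add: centers_def)
  ultimately show ?thesis
    using total[of centers] unfolding balls_def by linarith
qed

lemma le_unary_iff: "le_unary m n \<longleftrightarrow> m \<le> n"
  by (induction m n rule: le_unary.induct) auto

text \<open>The bound \<open>240\<close> of \<open>weights_le\<close> exceeds \<open>228\<close> by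
  the \<open>12\<close> demanded in \<open>settled_with\<close>. Underestimating outflow and
  overestimating inflow is safe.\<close>

lemma settled_sound:
  assumes "settled s" "agrees Q s" "separated Q"
  shows "balanced Q"
proof -
  have "24 * of_bool (some_zero (counts balls s)) + (12 + sum_over (max_inflow rules) (orbit s))
      \<le> drops (counts balls s) + sum_over (sure_outflow rules) (orbit s)"
    using assms(1) by (simp add: settled_def settled_with_def le_unary_iff add_if_eq)
  moreover have "sum_over (sure_outflow rules) (orbit s) \<le> outflow Q"
    unfolding outflow_def by (rule sum_over_sure_outflow_le[OF agrees_orbit[OF assms(2)]])
  moreover have "inflow Q \<le> sum_over (max_inflow rules) (orbit s)"
    unfolding inflow_def by (rule inflow_le_sum_over[OF agrees_orbit[OF assms(2)]])
  ultimately show ?thesis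
    using weights_le[OF assms(2,3)] by (simp add: balanced_def)
qed

text \<open>Some site of the clause is a codeword. The walk along the clause marks each site before
  the first such one as \<open>No\<close> and then enters its branch, which is covered by the
  matching subtree or else by \<open>settled\<close>.\<close>

lemma clause_check_sound:
  assumes "\<And>f s. f \<in> set fs \<Longrightarrow> f s \<Longrightarrow> agrees Q s \<Longrightarrow> balanced Q"
    and "clause_check xs fs s" "agrees Q s" "separated Q" "\<exists>x\<in>set xs. Q x"
  shows "balanced Q"
  using assms
proof (induction xs arbitrary: fs s)
  case (Cons x xs)
  show ?case
  proof (cases "look x s")
    case Unknown
    show ?thesis
    proof (cases "Q x")
      case True
      then have ag: "agrees Q (upd x Yes s)"
        using Cons.prems(3) by (rule agrees_upd_Yes[rotated])
      show ?thesis
        using Cons.prems(1,2) Unknown ag settled_sound[OF _ ag Cons.prems(4)] by (cases fs) auto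
    next
      case False
      then have ag: "agrees Q (upd x No s)" and ex: "\<exists>x\<in>set xs. Q x"
        using Cons.prems(3,5) by (auto intro: agrees_upd_No)
      \<comment> \<open>\<open>tl\<close> covers both situations: it drops the subtree of
        \<open>x\<close>, and it keeps an exhausted list empty.\<close>
      have "clause_check xs (tl fs) (upd x No s)"
        using Cons.prems(2) Unknown by (cases fs) auto
      moreover have "balanced Q" if "f \<in> set (tl fs)" "f s" "agrees Q s" for f s
        using Cons.prems(1) that by (cases fs) auto
      ultimately show ?thesis
        using ag ex Cons.prems(4) Cons.IH by blast
    qed
  next
    case Yes
    then show ?thesis
      using Cons.prems(2) by simp
  next
    case No
    then have "\<exists>x\<in>set xs. Q x" "clause_check xs fs s"
      using Cons.prems agreesD(2)[OF Cons.prems(3) No] by auto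
    then show ?thesis
      using Cons.IH Cons.prems by blast
  qed
qed simp

text \<open>A node \<open>V\<close> is an exhaustive split, and at a node \<open>K\<close>
  separation supplies the codeword of the clause.\<close>

lemma check_sound: "check t s \<Longrightarrow> agrees Q s \<Longrightarrow> separated Q \<Longrightarrow> balanced Q"
proof (induction t arbitrary: s)
  case L
  then show ?case
    by (simp add: settled_sound)
next
  case (V x t t')
  then show ?case
    by (cases "Q x") (auto intro: agrees_upd_Yes agrees_upd_No)
next
  case (K u v ts)
  from K.prems(1) have ne: "u \<noteq> v" and ch: "clause_check (sep u v) (map check ts) s"
    by auto
  from ne K.prems(3) have "\<exists>x\<in>set (sep u v). Q x"
    by (simp add: separated_def)
  then show ?case
    by (rule clause_check_sound[rotated 4, OF _ _ ch K.prems(2,3)]) (use K.IH K.prems(3) in auto)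
qed

subsection \<open>Counting\<close>

lemma pos_eq_iff: "pos x = pos y \<longleftrightarrow> x = y"
  by (cases x; cases y; simp)

lemma pos_nonzero: "pos x \<noteq> (0, 0)"
  by (cases x) simp_all

lemma pos_bound: "\<bar>fst (pos x)\<bar> \<le> 4 \<and> \<bar>snd (pos x)\<bar> \<le> 4"
  by (cases x) simp_all

text \<open>Validates the table \<open>ball\<close> against the true balls; the codeword in the
  middle is the point \<open>(0, 0)\<close>.\<close>

lemma ball_eq: "frame (center_pos u) ` set ball_offsets = insert (0, 0) (pos ` set (ball u))"
  by (cases u) (auto simp: ball_offsets_def frame_def parity_sign_def)

lemma distinct_ball: "distinct (ball u)"
  by (cases u) simp_all

lemma centers_eq: "map center_pos centers = ball_offsets"
  by (simp add: centers_def ball_offsets_def)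

lemma center_pos_eq_iff: "center_pos u = center_pos v \<longleftrightarrow> u = v"
  by (cases u; cases v; simp)

definition hex_nbhd :: "int \<times> int \<Rightarrow> (int \<times> int) set" where
  "hex_nbhd u = frame u ` set ball_offsets"

lemma hex_nbhd_center:
  "hex_nbhd (frame c (center_pos u)) = insert c (frame c ` pos ` set (ball u))"
proof -
  have "hex_nbhd (frame c (center_pos u)) = frame c ` (frame (center_pos u) ` set ball_offsets)"
    by (simp add: hex_nbhd_def image_image frame_frame)
  then show ?thesis
    by (simp add: ball_eq)
qed

lemma hex_nbhd_sym:
  assumes "w \<in> hex_nbhd c"
  shows "c \<in> hex_nbhd w"
proof -
  \<comment> \<open>Each offset has an inverse for the operation \<open>frame\<close> that is again
    an offset.\<close>
  have "\<forall>b\<in>set ball_offsets. \<exists>b'\<in>set ball_offsets. frame b b' = (0, 0)"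
    by (simp add: ball_offsets_def frame_def parity_sign_def)
  moreover obtain b where "b \<in> set ball_offsets" "w = frame c b"
    using assms by (auto simp: hex_nbhd_def)
  ultimately obtain b' where "b' \<in> set ball_offsets" "frame w b' = c"
    by (metis frame_frame frame_zero)
  then show ?thesis
    by (auto simp: hex_nbhd_def)
qed

lemma frame_Q_box:
  assumes "c \<in> Q_box n" "\<bar>fst x\<bar> \<le> int m" "\<bar>snd x\<bar> \<le> int m"
  shows "frame c x \<in> Q_box (n + m)"
  using assms by (auto simp: Q_box_def frame_def parity_sign_def)

lemma hex_nbhd_Q_box: "c \<in> Q_box n \<Longrightarrow> hex_nbhd c \<subseteq> Q_box (n + 2)"
proof -
  assume "c \<in> Q_box n"
  moreover have "\<bar>fst b\<bar> \<le> int 2 \<and> \<bar>snd b\<bar> \<le> int 2" if "b \<in> set ball_offsets" for b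
    using that by (auto simp: ball_offsets_def)
  ultimately show ?thesis
    using frame_Q_box[of c n _ 2] by (auto simp: hex_nbhd_def)
qed

lemma finite_hex_nbhd [simp]: "finite (hex_nbhd u)"
  by (simp add: hex_nbhd_def)

section \<open>Cancellation of the movements\<close>

fun aligned :: "(site \<Rightarrow> site) \<Rightarrow> rule \<Rightarrow> bool" where
  "aligned g (a, p, q, ls) \<longleftrightarrow> frame (pos (g p)) (pos (g q)) = (0, 0) \<and>
     list_all (\<lambda>l. pos (g (fst (snd l))) = frame (pos (g p)) (pos (g (snd (snd l))))) ls"

text \<open>Sender and receiver mean the same vertices: this is what makes the movements cancel.\<close>

lemma rules_aligned: "list_all (\<lambda>g. list_all (aligned g) rules) syms"
  by code_simp

definition local_code :: "(int \<times> int) set \<Rightarrow> int \<times> int \<Rightarrow> site \<Rightarrow> bool" where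
  "local_code C c x \<longleftrightarrow> frame c (pos x) \<in> C"

text \<open>By alignment the conditions of both sides concern the same vertices. Membership of the
  sender in \<open>C\<close> becomes the condition at \<open>q\<close>, and the condition at
  \<open>p\<close> becomes membership of the receiver.\<close>

lemma sends_iff_receives:
  assumes "aligned g (a, p, q, ls)"
  shows "c \<in> C \<and> sends (a, p, q, ls) (local_code C c \<circ> g) \<longleftrightarrow>
    frame c (pos (g p)) \<in> C \<and> receives (a, p, q, ls) (local_code C (frame c (pos (g p))) \<circ> g)"
proof -
  have "local_code C (frame c (pos (g p))) (g q) \<longleftrightarrow> c \<in> C"
    using assms by (simp add: local_code_def frame_frame)
  moreover have "local_code C (frame c (pos (g p))) (g (snd (snd l))) \<longleftrightarrow> local_code C c (g (fst (snd l)))"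
    if "l \<in> set ls" for l
  proof -
    have "pos (g (fst (snd l))) = frame (pos (g p)) (pos (g (snd (snd l))))"
      using assms that by (auto simp: list_all_iff)
    then show ?thesis
      by (simp add: local_code_def frame_frame)
  qed
  ultimately show ?thesis
    by (auto simp: local_code_def[of C c "g p"])
qed

lemma sum_sum_list_swap: "(\<Sum>c\<in>A. \<Sum>g\<leftarrow>gs. f c g) = (\<Sum>g\<leftarrow>gs. \<Sum>c\<in>A. f c g)"
  for f :: "'a \<Rightarrow> 'b \<Rightarrow> nat"
  by (induction gs) (simp_all add: sum.distrib)

lemma sum_mult_of_bool:
  fixes k :: nat
  shows "finite A \<Longrightarrow> (\<Sum>x\<in>A. k * of_bool (P x)) = k * card {x \<in> A. P x}"
  by (simp add: sum_distrib_left[symmetric] sum_of_bool_eq Int_def del: sum_mult_of_bool_eq)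

text \<open>For a fixed rule and symmetry, mapping senders to receivers is injective and changes
  each coordinate by at most \<open>4\<close>.\<close>

lemma outflow_le_inflow:
  "(\<Sum>c\<in>C \<inter> Q_box m. outflow (local_code C c)) \<le> (\<Sum>d\<in>C \<inter> Q_box (m + 4). inflow (local_code C d))"
proof -
  have one: "(\<Sum>c\<in>C \<inter> Q_box m. fst r * of_bool (sends r (local_code C c \<circ> g)))
      \<le> (\<Sum>d\<in>C \<inter> Q_box (m + 4). fst r * of_bool (receives r (local_code C d \<circ> g)))"
    if g: "g \<in> set syms" and r: "r \<in> set rules" for g r
  proof -
    obtain a p q ls where req: "r = (a, p, q, ls)"
      by (cases r) auto
    have al: "aligned g (a, p, q, ls)"
      using rules_aligned g r unfolding list_all_iff req by blast
    let ?h = "\<lambda>c. frame c (pos (g p))"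
    let ?S = "{c \<in> C \<inter> Q_box m. sends r (local_code C c \<circ> g)}"
    let ?R = "{d \<in> C \<inter> Q_box (m + 4). receives r (local_code C d \<circ> g)}"
    \<comment> \<open>The receiver finds its sender again through \<open>q\<close>, which makes
      \<open>?h\<close> injective.\<close>
    have inv: "frame (?h c) (pos (g q)) = c" for c
      using al by (simp add: frame_frame)
    have "?h ` ?S \<subseteq> ?R"
    proof
      fix d
      assume "d \<in> ?h ` ?S"
      then obtain c where c: "c \<in> C" "c \<in> Q_box m" "sends r (local_code C c \<circ> g)" "d = ?h c"
        by auto
      then have "d \<in> C \<and> receives r (local_code C d \<circ> g)"
        using sends_iff_receives[OF al, of c C] by (simp add: req)
      moreover have "d \<in> Q_box (m + 4)"
        using c pos_bound[of "g p"] by (auto intro!: frame_Q_box)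
      ultimately show "d \<in> ?R"
        by simp
    qed
    moreover have "inj_on ?h ?S"
      by (rule inj_on_inverseI[where g = "\<lambda>d. frame d (pos (g q))"]) (rule inv)
    moreover have "finite ?R"
      by simp
    ultimately have "card ?S \<le> card ?R"
      using card_inj_on_le by blast
    then show ?thesis
      unfolding sum_mult_of_bool[OF finite_Int[OF disjI2[OF finite_Q_box]]] by (rule mult_le_mono2)
  qed
  show ?thesis
    unfolding outflow_def inflow_def sum_sum_list_swap
    by (intro sum_list_mono one)
qed

text \<open>A uniform bound is enough, as it serves only for codewords in the boundary ring.\<close>

lemma inflow_bound: "inflow Q \<le> (\<Sum>g\<leftarrow>syms. \<Sum>r\<leftarrow>rules. fst r)"
  unfolding inflow_def by (intro sum_list_mono) simp

section \<open>Double counting for a fixed identifying code\<close>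

context
  fixes C :: "(int \<times> int) set"
  assumes code: "identifying_code hex_V hex_E 2 C"
begin

lemma nbhd_nonempty: "hex_nbhd u \<inter> C \<noteq> {}"
  and nbhd_distinct: "u \<noteq> v \<Longrightarrow> hex_nbhd u \<inter> C \<noteq> hex_nbhd v \<inter> C"
  using code unfolding identifying_code_def I_set_def hex_ball hex_nbhd_def
  unfolding hex_V_def by blast+

text \<open>Different centers are different vertices and have different sets of codewords. The
  codeword \<open>c\<close> lies in both balls if it is in \<open>C\<close>, so the difference
  occurs at one of the named sites.\<close>

lemma local_separated: "separated (local_code C c)"
proof -
  have "\<exists>x\<in>set (sep u v). local_code C c x" if "u \<noteq> v" for u v
  proof -
    have "frame c (center_pos u) \<noteq> frame c (center_pos v)"
      using that by (simp add: frame_inj_iff center_pos_eq_iff)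
    then have "insert c (frame c ` pos ` set (ball u)) \<inter> C \<noteq> insert c (frame c ` pos ` set (ball v)) \<inter> C"
      using nbhd_distinct by (simp add: hex_nbhd_center[symmetric])
    then obtain x where "x \<in> set (ball u) \<and> x \<notin> set (ball v) \<or> x \<in> set (ball v) \<and> x \<notin> set (ball u)"
        "frame c (pos x) \<in> C"
      by blast
    then show ?thesis
      by (auto simp: sep_def local_code_def)
  qed
  then show ?thesis
    by (simp add: separated_def)
qed

text \<open>The extra one is \<open>c\<close> itself, which lies in each of the ten balls and is not
  among the sites.\<close>

lemma card_nbhd_center:
  assumes "c \<in> C"
  shows "card (hex_nbhd (frame c (center_pos u)) \<inter> C) = Suc (hits (local_code C c) u)"
proof -
  let ?X = "set (filter (local_code C c) (ball u))"
  have "hex_nbhd (frame c (center_pos u)) \<inter> C = insert c ((\<lambda>x. frame c (pos x)) ` ?X)"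
    using assms by (auto simp: hex_nbhd_center local_code_def)
  moreover have "c \<notin> (\<lambda>x. frame c (pos x)) ` ?X"
  proof -
    have "c \<noteq> frame c (pos x)" for x
      using frame_inj_iff[of c "(0, 0)" "pos x"] pos_nonzero[of x] by simp
    then show ?thesis
      by blast
  qed
  moreover have "card ((\<lambda>x. frame c (pos x)) ` ?X) = card ?X"
    by (intro card_image inj_onI) (simp add: frame_inj_iff pos_eq_iff)
  moreover have "card ?X = hits (local_code C c) u"
    unfolding hits_def by (intro distinct_card distinct_filter distinct_ball)
  ultimately show ?thesis
    by simp
qed

text \<open>What \<open>w\<close> gives to each codeword it sees, in units of \<open>1/48\<close>;
  the subtraction removes the receiving codeword, as \<open>weight\<close> counts only the
  others.\<close>

definition share_of :: "int \<times> int \<Rightarrow> nat" where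
  "share_of w = weight (card (hex_nbhd w \<inter> C) - 1)"

text \<open>Equality for up to four codewords; beyond that the lower limit \<open>12\<close> on the
  share gives more than \<open>48\<close>.\<close>

lemma share_total: "48 \<le> card (hex_nbhd w \<inter> C) * share_of w"
proof -
  have "card (hex_nbhd w \<inter> C) \<noteq> 0"
    using nbhd_nonempty by simp
  then obtain k where "card (hex_nbhd w \<inter> C) = Suc k"
    by (cases "card (hex_nbhd w \<inter> C)") auto
  then show ?thesis
    by (auto simp: share_of_def weight_def)
qed

text \<open>The vertices giving to \<open>c\<close> are the ten centers around it, so the
  certificate applies to the code as seen from \<open>c\<close>.\<close>

lemma shares_balanced:
  assumes "c \<in> C"
  shows "(\<Sum>w\<in>hex_nbhd c. share_of w) + inflow (local_code C c) \<le> 228 + outflow (local_code C c)"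
proof -
  have "(\<Sum>w\<in>hex_nbhd c. share_of w) = (\<Sum>b\<in>set ball_offsets. share_of (frame c b))"
    unfolding hex_nbhd_def by (subst sum.reindex) (auto intro: inj_onI simp: frame_inj_iff)
  also have "\<dots> = (\<Sum>b\<leftarrow>ball_offsets. share_of (frame c b))"
    by (rule sum.distinct_set_conv_list) (simp add: ball_offsets_def)
  also have "\<dots> = (\<Sum>u\<leftarrow>centers. weight (hits (local_code C c) u))"
    unfolding centers_eq[symmetric] by (simp add: comp_def share_of_def card_nbhd_center[OF assms])
  finally show ?thesis
    using check_sound[OF check_cert agrees_blank local_separated[of c]] by (simp add: balanced_def)
qed

text \<open>Every vertex of the inner box gives at least \<open>48\<close>, the codewords within
  distance \<open>2\<close> of the box receive all of it, and the movements cancel except for a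
  contribution of the ring.\<close>

lemma code_count:
  "48 * card (Q_box n) \<le> 228 * card (C \<inter> Q_box (n + 2))
    + (\<Sum>g\<leftarrow>syms. \<Sum>r\<leftarrow>rules. fst r) * card (Q_box (n + 6) - Q_box (n + 2))"
proof -
  let ?K = "\<Sum>g\<leftarrow>syms. \<Sum>r\<leftarrow>rules. fst r"
  let ?D = "C \<inter> Q_box (n + 2)"
  have "48 * card (Q_box n) = (\<Sum>w\<in>Q_box n. 48)"
    by simp
  also have "\<dots> \<le> (\<Sum>w\<in>Q_box n. \<Sum>c\<in>hex_nbhd w \<inter> C. share_of w)"
    by (intro sum_mono) (simp add: share_total)
  also have "\<dots> = (\<Sum>(w, c)\<in>(SIGMA w:Q_box n. hex_nbhd w \<inter> C). share_of w)"
    by (subst sum.Sigma) auto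
  \<comment> \<open>Exchanges the roles of \<open>w\<close> and \<open>c\<close>. Each codeword near
    the box is credited with all of its ten vertices, including those outside the box, which only
    enlarges the sum.\<close>
  also have "\<dots> \<le> (\<Sum>(w, c)\<in>(\<lambda>(c, w). (w, c)) ` (SIGMA c:?D. hex_nbhd c). share_of w)"
  proof (rule sum_mono2)
    show "(SIGMA w:Q_box n. hex_nbhd w \<inter> C) \<subseteq> (\<lambda>(c, w). (w, c)) ` (SIGMA c:?D. hex_nbhd c)"
      using hex_nbhd_Q_box hex_nbhd_sym by force
  qed auto
  also have "\<dots> = (\<Sum>c\<in>?D. \<Sum>w\<in>hex_nbhd c. share_of w)"
    by (subst sum.reindex) (auto simp: inj_on_def sum.Sigma case_prod_unfold)
  finally have shares: "48 * card (Q_box n) \<le> (\<Sum>c\<in>?D. \<Sum>w\<in>hex_nbhd c. share_of w)" .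
  have "(\<Sum>c\<in>?D. \<Sum>w\<in>hex_nbhd c. share_of w) + (\<Sum>c\<in>?D. inflow (local_code C c))
      \<le> 228 * card ?D + (\<Sum>c\<in>?D. outflow (local_code C c))"
  proof -
    have "(\<Sum>c\<in>?D. (\<Sum>w\<in>hex_nbhd c. share_of w) + inflow (local_code C c))
        \<le> (\<Sum>c\<in>?D. 228 + outflow (local_code C c))"
      by (intro sum_mono shares_balanced) auto
    then show ?thesis
      by (simp add: sum.distrib mult.commute)
  qed
  moreover have "(\<Sum>c\<in>?D. outflow (local_code C c))
      \<le> (\<Sum>c\<in>?D. inflow (local_code C c)) + ?K * card (Q_box (n + 6) - Q_box (n + 2))"
  proof -
    let ?B = "C \<inter> (Q_box (n + 6) - Q_box (n + 2))"
    have split: "C \<inter> Q_box (n + 6) = ?D \<union> ?B"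
      using Q_box_mono[of "n + 2" "n + 6"] by auto
    \<comment> \<open>What leaves \<open>?D\<close> arrives in \<open>Q_box (n + 6)\<close>. The
      inflow into \<open>?D\<close> also stands on the left of the summed balance and cancels; only
      the inflow into \<open>?B\<close> remains.\<close>
    have "(\<Sum>c\<in>?D. outflow (local_code C c)) \<le> (\<Sum>d\<in>C \<inter> Q_box (n + 6). inflow (local_code C d))"
      using outflow_le_inflow[of C "n + 2"] by (simp add: numeral_eq_Suc)
    also have "\<dots> = (\<Sum>d\<in>?D. inflow (local_code C d)) + (\<Sum>d\<in>?B. inflow (local_code C d))"
      unfolding split by (rule sum.union_disjoint) auto
    also have "(\<Sum>d\<in>?B. inflow (local_code C d)) \<le> (\<Sum>d\<in>?B. ?K)"
      by (intro sum_mono inflow_bound)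
    also have "(\<Sum>d\<in>?B. ?K) \<le> ?K * card (Q_box (n + 6) - Q_box (n + 2))"
      by (simp add: card_mono)
    finally show ?thesis
      by simp
  qed
  ultimately show ?thesis
    using shares by linarith
qed

end

theorem theorem1:
  fixes C :: "(int \<times> int) set"
  assumes "identifying_code hex_V hex_E 2 C"
  shows "code_density C \<ge> ereal (4 / 19)"
  using code_density_ge[OF code_count[OF assms]] .

end
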